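(* Let $p>3$ be a prime, $x\in\mathbb Z_p$ with $2x+1\not\equiv0\pmod p$, and $x'=(x-\langle x\rangle_p)/p$. Then $$\sum_{n=0}^{p-1}V_n(x)\equiv\frac{1+2x'}{1+2x}p+\frac{x'(x'+1)+1}{1+2x}p^3B_{p-2}(-x)\pmod{p^4}.$$ Consequently $$\sum_{n=0}^{p-1}\frac{V_n^{(3)}}{27^n}\equiv(-1)^{[p/3]}p+14p^3U_{p-3}\pmod{p^4},\quad\sum_{n=0}^{p-1}\frac{V_n^{(4)}}{64^n}\equiv(-1)^{\frac{p-1}2}p+13p^3E_{p-3}\pmod{p^4},$$ $$\sum_{n=0}^{p-1}\frac{V_n^{(6)}}{432^n}\equiv(-1)^{[p/3]}p+\tfrac{155}4p^3U_{p-3}\pmod{p^4}.$$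
   Context: For real $x$ and integer $k\ge0$, $\binom xk=x(x-1)\cdots(x-k+1)/k!$. $V_n(x)=\sum_{k=0}^n\binom nk\binom{n+k}k(-1)^k\binom xk\binom{-1-x}k$. $\mathbb Z_p$: rationals with denominator prime to $p$; congruences modulo powers of $p$ are in $\mathbb Z_p$; for $x\in\mathbb Z_p$, $\langle x\rangle_p\in\{0,\ldots,p-1\}$ with $x\equiv\langle x\rangle_p\pmod p$. $[y]$ is the floor. Bernoulli numbers: $B_0=1$, $\sum_{k=0}^{n-1}\binom nkB_k=0$ ($n\ge2$); $B_n(x)=\sum_{k=0}^n\binom nkB_kx^{n-k}$. Euler numbers: $E_{2n-1}=0$, $E_0=1$, $E_{2n}=-\sum_{k=1}^n\binom{2n}{2k}E_{2n-2k}$. $U_{2n-1}=0$, $U_0=1$, $U_{2n}=-2\sum_{k=1}^n\binom{2n}{2k}U_{2n-2k}$. $V_n^{(3)}=27^nV_n(-\tfrac13)$, $V_n^{(4)}=64^nV_n(-\tfrac14)$, $V_n^{(6)}=432^nV_n(-\tfrac16)$. *)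

theory Defs
  imports Complex_Main "HOL-Computational_Algebra.Primes"
begin

definition V :: "nat \<Rightarrow> 'a::field_char_0 \<Rightarrow> 'a" where
  "V n x = (\<Sum>k=0..n. of_nat (n choose k) * of_nat ((n + k) choose k) * (-1) ^ k
              * (x gchoose k) * ((-1 - x) gchoose k))"

definition V3 :: "nat \<Rightarrow> rat" where
  "V3 n = 27 ^ n * V n (- 1 / 3)"

definition V4 :: "nat \<Rightarrow> rat" where
  "V4 n = 64 ^ n * V n (- 1 / 4)"

definition V6 :: "nat \<Rightarrow> rat" where
  "V6 n = 432 ^ n * V n (- 1 / 6)"

text \<open>Here \<open>Zp p\<close> is the localization of the integers at \<open>p\<close>, as a subring of the rationals,
  and not the ring of \<open>p\<close>-adic integers.  Note that \<open>quotient_of\<close> returns the fraction in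
  lowest terms with positive denominator.\<close>

definition Zp :: "nat \<Rightarrow> rat set" where
  "Zp p = {x. coprime (snd (quotient_of x)) (int p)}"

text \<open>\<open>Zp_cong p k a b\<close> is the congruence of \<open>a\<close> and \<open>b\<close> modulo \<open>p\<close> to the power \<open>k\<close>
  in the ring \<open>Zp p\<close>; in particular it requires both sides to lie in that ring.\<close>

definition Zp_cong :: "nat \<Rightarrow> nat \<Rightarrow> rat \<Rightarrow> rat \<Rightarrow> bool" where
  "Zp_cong p k a b \<longleftrightarrow> a \<in> Zp p \<and> b \<in> Zp p \<and> (\<exists>c\<in>Zp p. a - b = of_nat p ^ k * c)"

text \<open>The residue is uniquely determined, and hence the description meaningful, for \<open>p\<close> prime
  and \<open>x\<close> in \<open>Zp p\<close>.\<close>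

definition Zp_residue :: "nat \<Rightarrow> rat \<Rightarrow> nat" where
  "Zp_residue p x = (THE r. r < p \<and> Zp_cong p 1 x (of_nat r))"

text \<open>The recursive definition solves \<open>\<Sum>k<m. (m choose k) * bernoulli k = 0\<close>, for \<open>m = n + 1\<close>,
  for its last term; see \<open>bernoulli_recurrence\<close> below.\<close>

fun bernoulli :: "nat \<Rightarrow> rat" where
  "bernoulli n = (if n = 0 then 1
     else - (\<Sum>k<n. of_nat ((n + 1) choose k) * bernoulli k) / of_nat (n + 1))"

declare bernoulli.simps [simp del]

lemma bernoulli_0: "bernoulli 0 = 1"
  by (simp add: bernoulli.simps)

lemma bernoulli_recurrence:
  assumes "n \<ge> 2"
  shows "(\<Sum>k=0..n - 1. of_nat (n choose k) * bernoulli k) = 0"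
proof -
  obtain m where n: "n = Suc m" and m: "m \<noteq> 0"
    using assms by (cases n) auto
  have "of_nat (m + 1) * bernoulli m = - (\<Sum>k<m. of_nat ((m + 1) choose k) * bernoulli k)"
    using m by (subst bernoulli.simps) (simp del: of_nat_add of_nat_Suc)
  moreover have "{0..m} = insert m {..<m}"
    by auto
  ultimately show ?thesis
    by (simp add: n)
qed

definition bernpoly :: "nat \<Rightarrow> rat \<Rightarrow> rat" where
  "bernpoly n x = (\<Sum>k=0..n. of_nat (n choose k) * bernoulli k * x ^ (n - k))"

fun E :: "nat \<Rightarrow> int" where
  "E n = (if n = 0 then 1 else if odd n then 0
     else - (\<Sum>k=1..n div 2. int (n choose (2 * k)) * E (n - 2 * k)))"

declare E.simps [simp del]

lemma E_recurrence:
  "E 0 = 1"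
  "n \<ge> 1 \<Longrightarrow> E (2 * n - 1) = 0"
  "n \<ge> 1 \<Longrightarrow> E (2 * n) = - (\<Sum>k=1..n. int ((2 * n) choose (2 * k)) * E (2 * n - 2 * k))"
  by (subst E.simps; simp)+

fun U :: "nat \<Rightarrow> int" where
  "U n = (if n = 0 then 1 else if odd n then 0
     else - 2 * (\<Sum>k=1..n div 2. int (n choose (2 * k)) * U (n - 2 * k)))"

declare U.simps [simp del]

lemma U_recurrence:
  "U 0 = 1"
  "n \<ge> 1 \<Longrightarrow> U (2 * n - 1) = 0"
  "n \<ge> 1 \<Longrightarrow> U (2 * n) = - 2 * (\<Sum>k=1..n. int ((2 * n) choose (2 * k)) * U (2 * n - 2 * k))"
  by (subst U.simps; simp)+

end

theory Submission
  imports Defs "HOL-Computational_Algebra.Formal_Power_Series" "HOL-Number_Theory.Residues"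
begin

text \<open>
  Write \<open>S(x)\<close> for the sum over \<open>n < p\<close> of \<open>V n x\<close>.  Summing over \<open>n\<close> first expresses \<open>S(x)\<close> through
  \<open>W k x = (x gchoose k) * ((- 1 - x) gchoose k)\<close> and the partial products \<open>P k\<close> of the sine product.
  Both \<open>(x - k) * W k x\<close> and \<open>(x + k) * W k (x - 1)\<close> equal \<open>x * P k x\<close>, so that the denominators \<open>2 k + 1\<close>
  cancel in \<open>(2 x + 1) * S(x) - (2 x - 1) * S(x - 1)\<close>, and Abel summation turns this difference into \<open>2 p\<close>
  times an expression in \<open>P\<close> which is easily found modulo \<open>p ^ 3\<close>.  Starting from \<open>S(0) = p\<close>, this determines
  \<open>S\<close> modulo \<open>p ^ 4\<close> at all natural numbers, in terms of the sums of \<open>1 / j ^ 2\<close>, which are values of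
  the Bernoulli polynomial modulo \<open>p\<close>.  Since \<open>S\<close> is a polynomial over \<open>Zp p\<close>, and natural numbers
  approximate elements of \<open>Zp p\<close>, the congruence follows for all \<open>x\<close>.  The special cases use the values of odd
  Bernoulli polynomials at \<open>1/3\<close>, \<open>1/4\<close> and \<open>1/6\<close>, obtained from generating functions.
\<close>

unbundle fps_syntax

section \<open>The ring of \<open>p\<close>-integral rationals\<close>

text \<open>The reduced denominator divides every other denominator of the same number, so a single
  representation with denominator prime to \<open>p\<close> suffices. This makes closure under sums
  and products immediate.\<close>

lemma Zp_iff_fraction:
  "x \<in> Zp p \<longleftrightarrow> (\<exists>a b. b \<noteq> 0 \<and> coprime b (int p) \<and> x = of_int a / of_int b)"
proof -
  obtain c d where cd: "quotient_of x = (c, d)"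
    by fastforce
  have d: "d > 0" "coprime c d" and x: "x = of_int c / of_int d"
    using quotient_of_denom_pos[OF cd] quotient_of_coprime[OF cd] quotient_of_div[OF cd] by auto
  have "coprime d (int p)" if b: "b \<noteq> 0" "coprime b (int p)" and ab: "x = of_int a / of_int b" for a b
  proof -
    have "of_int c / of_int d = (of_int a / of_int b :: rat)"
      using x ab by (rule trans[OF sym])
    then have "rat_of_int (a * d) = of_int (c * b)"
      using b(1) d(1) by (simp add: frac_eq_eq)
    then have "a * d = c * b"
      by (simp only: of_int_eq_iff)
    then have "d dvd c * b"
      by (rule dvdI[OF trans[OF sym mult.commute]])
    then have "d dvd b"
      using d(2) by (simp add: coprime_commute coprime_dvd_mult_right_iff)
    then show ?thesis
      by (rule coprime_divisors[OF _ dvd_refl b(2)])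
  qed
  moreover have "x \<in> Zp p \<longleftrightarrow> coprime d (int p)"
    by (simp add: Zp_def cd)
  moreover have "d \<noteq> 0"
    using d(1) by simp
  ultimately show ?thesis
    using x by blast
qed

lemma Zp_fractionI: "b \<noteq> 0 \<Longrightarrow> coprime b (int p) \<Longrightarrow> of_int a / of_int b \<in> Zp p"
  unfolding Zp_iff_fraction by blast

lemma Zp_of_int [simp]: "of_int a \<in> Zp p"
  using Zp_fractionI[of 1 p a] by simp

lemma Zp_of_nat [simp]: "of_nat n \<in> Zp p"
  using Zp_of_int[of "int n"] by simp

lemma Zp_0 [simp]: "0 \<in> Zp p" and Zp_1 [simp]: "1 \<in> Zp p"
  using Zp_of_int[of 0] Zp_of_int[of 1] by simp_all

lemma Zp_numeral [simp]: "numeral n \<in> Zp p"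
  using Zp_of_int[of "numeral n"] by simp

lemma Zp_add [simp]:
  assumes "x \<in> Zp p" and "y \<in> Zp p"
  shows "x + y \<in> Zp p"
proof -
  obtain a b c d where ab: "b \<noteq> 0" "coprime b (int p)" "x = of_int a / of_int b"
      and cd: "d \<noteq> 0" "coprime d (int p)" "y = of_int c / of_int d"
    using assms unfolding Zp_iff_fraction by blast
  have "x + y = of_int (a * d + c * b) / of_int (b * d)"
    using ab(1) cd(1) by (simp add: ab(3) cd(3) add_frac_eq)
  moreover have "b * d \<noteq> 0" "coprime (b * d) (int p)"
    using ab(1,2) cd(1,2) by simp_all
  ultimately show ?thesis
    using Zp_fractionI by metis
qed

lemma Zp_mult [simp]:
  assumes "x \<in> Zp p" and "y \<in> Zp p"
  shows "x * y \<in> Zp p"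
proof -
  obtain a b c d where ab: "b \<noteq> 0" "coprime b (int p)" "x = of_int a / of_int b"
      and cd: "d \<noteq> 0" "coprime d (int p)" "y = of_int c / of_int d"
    using assms unfolding Zp_iff_fraction by blast
  have "x * y = of_int (a * c) / of_int (b * d)"
    using ab(1) cd(1) by (simp add: ab(3) cd(3) add_frac_eq)
  moreover have "b * d \<noteq> 0" "coprime (b * d) (int p)"
    using ab(1,2) cd(1,2) by simp_all
  ultimately show ?thesis
    using Zp_fractionI by metis
qed

lemma Zp_uminus [simp]: "x \<in> Zp p \<Longrightarrow> - x \<in> Zp p"
  using Zp_mult[OF Zp_of_int[of "-1"]] by simp

lemma Zp_diff [simp]: "x \<in> Zp p \<Longrightarrow> y \<in> Zp p \<Longrightarrow> x - y \<in> Zp p"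
  using Zp_add[of x p "- y"] by simp

lemma Zp_power [simp]: "x \<in> Zp p \<Longrightarrow> x ^ n \<in> Zp p"
  by (induction n) auto

lemma Zp_sum [simp]: "(\<And>i. i \<in> A \<Longrightarrow> f i \<in> Zp p) \<Longrightarrow> sum f A \<in> Zp p"
  by (induction A rule: infinite_finite_induct) auto

lemma Zp_inverse_of_int: "coprime b (int p) \<Longrightarrow> b \<noteq> 0 \<Longrightarrow> inverse (of_int b) \<in> Zp p"
  using Zp_fractionI[of b p 1] by (simp add: inverse_eq_divide)

section \<open>Congruences modulo powers of p\<close>

lemma Zp_cong_refl [simp]: "a \<in> Zp p \<Longrightarrow> Zp_cong p k a a"
  by (auto simp: Zp_cong_def intro: bexI[of _ 0])

lemma Zp_congD: "Zp_cong p k a b \<Longrightarrow> a \<in> Zp p" "Zp_cong p k a b \<Longrightarrow> b \<in> Zp p"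
  by (auto simp: Zp_cong_def)

lemma Zp_congI: "a \<in> Zp p \<Longrightarrow> b \<in> Zp p \<Longrightarrow> c \<in> Zp p \<Longrightarrow> a - b = of_nat p ^ k * c \<Longrightarrow> Zp_cong p k a b"
  by (auto simp: Zp_cong_def)

lemma Zp_congE:
  assumes "Zp_cong p k a b"
  obtains c where "c \<in> Zp p" and "a = b + of_nat p ^ k * c" and "b \<in> Zp p"
  using assms by (auto simp: Zp_cong_def algebra_simps)

lemma Zp_cong_add:
  assumes "Zp_cong p k a b" and "Zp_cong p k c d"
  shows "Zp_cong p k (a + c) (b + d)"
proof -
  obtain e f where "e \<in> Zp p" "a = b + of_nat p ^ k * e" "f \<in> Zp p" "c = d + of_nat p ^ k * f"
    using assms by (meson Zp_congE)
  with assms[THEN Zp_congD(2)] show ?thesis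
    by (intro Zp_congI[where c = "e + f"]) (auto simp: algebra_simps)
qed

lemma Zp_cong_mult:
  assumes "Zp_cong p k a b" and "Zp_cong p k c d"
  shows "Zp_cong p k (a * c) (b * d)"
proof -
  obtain e f where "e \<in> Zp p" "a = b + of_nat p ^ k * e" "f \<in> Zp p" "c = d + of_nat p ^ k * f"
    using assms by (meson Zp_congE)
  with assms[THEN Zp_congD(2)] show ?thesis
    by (intro Zp_congI[where c = "e * d + b * f + of_nat p ^ k * e * f"]) (auto simp: algebra_simps)
qed

lemma Zp_cong_uminus: "Zp_cong p k a b \<Longrightarrow> Zp_cong p k (- a) (- b)"
  using Zp_cong_mult[OF Zp_cong_refl[OF Zp_of_int[of "-1"]]] by simp

lemma Zp_cong_diff: "Zp_cong p k a b \<Longrightarrow> Zp_cong p k c d \<Longrightarrow> Zp_cong p k (a - c) (b - d)"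
  using Zp_cong_add[of p k a b "- c" "- d"] Zp_cong_uminus by simp

lemma Zp_cong_power: "Zp_cong p k a b \<Longrightarrow> Zp_cong p k (a ^ n) (b ^ n)"
  by (induction n) (auto intro: Zp_cong_mult)

lemma Zp_cong_sum: "(\<And>i. i \<in> A \<Longrightarrow> Zp_cong p k (f i) (g i)) \<Longrightarrow> Zp_cong p k (sum f A) (sum g A)"
  by (induction A rule: infinite_finite_induct) (auto intro: Zp_cong_add)

lemma Zp_cong_sym: "Zp_cong p k a b \<Longrightarrow> Zp_cong p k b a"
  by (elim Zp_congE, rule Zp_congI[where c = "- c" for c]) auto

lemma Zp_cong_trans [trans]:
  assumes "Zp_cong p k a b" and "Zp_cong p k b c"
  shows "Zp_cong p k a c"
  using Zp_cong_diff[OF Zp_cong_add[OF assms] Zp_cong_refl[OF Zp_congD(2)[OF assms(1)]]] by simp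

lemma Zp_cong_mono: "Zp_cong p j a b \<Longrightarrow> k \<le> j \<Longrightarrow> Zp_cong p k a b"
  by (elim Zp_congE, rule Zp_congI[where c = "of_nat p ^ (j - k) * c" for c])
     (auto simp flip: power_add mult.assoc)

lemma Zp_cong_scale: "Zp_cong p k a b \<Longrightarrow> Zp_cong p (j + k) (of_nat p ^ j * a) (of_nat p ^ j * b)"
  by (elim Zp_congE, rule Zp_congI[where c = c for c]) (auto simp: algebra_simps power_add)

lemma Zp_cong_cancel:
  assumes "Zp_cong p k (c * a) (c * b)" and "inverse c \<in> Zp p" and "c \<noteq> 0"
  shows "Zp_cong p k a b"
  using Zp_cong_mult[OF Zp_cong_refl[OF assms(2)] assms(1)] assms(3)
  by (simp flip: mult.assoc)

lemma Zp_inverse_of_nat: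
  assumes "prime p" and "0 < j" and "j < p"
  shows "inverse (of_nat j) \<in> Zp p"
proof -
  have "coprime p j"
    using assms nat_dvd_not_less prime_imp_coprime by blast
  then show ?thesis
    using Zp_inverse_of_int[of "int j" p] assms(2) by (simp add: coprime_commute)
qed

lemma Zp_divide_of_nat:
  "prime p \<Longrightarrow> 0 < j \<Longrightarrow> j < p \<Longrightarrow> x \<in> Zp p \<Longrightarrow> x / of_nat j \<in> Zp p"
  by (simp add: divide_inverse Zp_inverse_of_nat)

lemma Zp_cong_divide_of_nat:
  assumes "prime p" and "0 < j" and "j < p" and "Zp_cong p k x y"
  shows "Zp_cong p k (x / of_nat j) (y / of_nat j)"
  unfolding divide_inverse by (intro Zp_cong_mult assms Zp_cong_refl Zp_inverse_of_nat)

text \<open>Density of the natural numbers: this later transfers congruences from natural arguments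
  to all of \<open>Zp p\<close>.\<close>

lemma Zp_cong_approximation:
  assumes "prime p" and "x \<in> Zp p"
  obtains n :: nat where "Zp_cong p k x (of_nat n)"
proof -
  obtain a b where ab: "b \<noteq> 0" "coprime b (int p)" "x = of_int a / of_int b"
    using assms(2) unfolding Zp_iff_fraction by blast
  have "coprime b (int p ^ k)"
    using ab(2) by simp
  \<comment> \<open>By Bezout, \<open>c\<close> inverts \<open>b\<close> modulo
    \<open>p ^ k\<close>, so \<open>a * c\<close> approximates \<open>a / b\<close>.\<close>
  then obtain c d where cd: "c * b + d * int p ^ k = 1"
    by (metis bezout_int coprime_iff_gcd_eq_1)
  define n where "n = nat (a * c mod int p ^ k)"
  have "int p ^ k > 0"
    using assms(1) prime_gt_0_nat by simp
  then have n: "int n = a * c mod int p ^ k"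
    by (simp add: n_def)
  define q where "q = a * c div int p ^ k"
  have "int n = a * c - int p ^ k * q"
    unfolding n q_def by (simp add: minus_mult_div_eq_mod)
  then have "(of_int (int n) :: rat) = of_int (a * c - int p ^ k * q)"
    by (rule arg_cong)
  moreover have "(of_int (c * b + d * int p ^ k) :: rat) = of_int 1"
    using cd by (rule arg_cong)
  ultimately have "of_nat n = of_int a * of_int c - of_nat p ^ k * (of_int q :: rat)"
      "1 - of_int c * of_int b = of_nat p ^ k * (of_int d :: rat)"
    by (simp_all add: algebra_simps)
  then have "x - of_nat n = of_nat p ^ k * (x * of_int d + of_int q)"
  proof -
    assume n: "of_nat n = of_int a * of_int c - of_nat p ^ k * (of_int q :: rat)"
      and cb: "1 - of_int c * of_int b = of_nat p ^ k * (of_int d :: rat)"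
    have "x = x * (1 - of_int c * of_int b) + of_int a * of_int c"
      using ab(1,3) by (simp add: algebra_simps)
    then show ?thesis
      unfolding cb using n by (simp add: algebra_simps)
  qed
  then show ?thesis
    using assms(2) by (intro that Zp_congI[where c = "x * of_int d + of_int q"]) auto
qed

lemma Zp_cong_of_nat_eq:
  assumes "Zp_cong p 1 (of_nat m) (of_nat n)" and "m < p" and "n < p"
  shows "m = n"
proof -
  obtain c where "c \<in> Zp p" and c: "of_nat m = of_nat n + of_nat p * c"
    using assms(1) by (auto elim: Zp_congE)
  then obtain a b where ab: "b \<noteq> 0" "coprime b (int p)" "c = of_int a / of_int b"
    unfolding Zp_iff_fraction by blast
  have "(of_int ((int m - int n) * b) :: rat) = of_int (int p * a)"
    using c ab(1) by (simp add: ab(3) field_simps)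
  then have "(int m - int n) * b = int p * a"
    by (simp only: of_int_eq_iff)
  then have "int p dvd (int m - int n) * b"
    by simp
  then have "int p dvd int m - int n"
    using ab(2) by (simp add: coprime_commute coprime_dvd_mult_left_iff)
  then have "int m mod int p = int n mod int p"
    by (simp add: mod_eq_dvd_iff)
  then show ?thesis
    using assms(2,3) by simp
qed

lemma Zp_residue_eqI:
  assumes "prime p" and "Zp_cong p 1 x (of_nat r)" and "r < p"
  shows "Zp_residue p x = r"
  unfolding Zp_residue_def
proof (rule the_equality)
  show "s = r" if "s < p \<and> Zp_cong p 1 x (of_nat s)" for s
    using that assms Zp_cong_of_nat_eq Zp_cong_sym Zp_cong_trans by blast
qed (use assms in simp)

lemma Zp_inverse:
  assumes "prime p" and "x \<in> Zp p" and "\<not> Zp_cong p 1 x 0"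
  shows "inverse x \<in> Zp p"
proof -
  obtain a b where ab: "b \<noteq> 0" "coprime b (int p)" "x = of_int a / of_int b"
    using assms(2) unfolding Zp_iff_fraction by blast
  have "coprime a (int p)"
  proof (rule ccontr)
    assume "\<not> coprime a (int p)"
    then have "int p dvd a"
      using assms(1) prime_imp_coprime[of "int p" a] by (auto simp: coprime_commute)
    then obtain c where "a = int p * c" ..
    then have "Zp_cong p 1 x 0"
      using ab assms(2) by (intro Zp_congI[where c = "of_int c / of_int b"] Zp_fractionI) auto
    with assms(3) show False ..
  qed
  moreover have "a \<noteq> 0"
    using assms(3) ab(3) by auto
  ultimately show ?thesis
    using Zp_fractionI[of a p b] ab(3) by simp
qed

section \<open>A recurrence for the sum\<close>

text \<open>Up to the constant \<open>(- 1) ^ k / fact k ^ 2\<close>, this is the product of the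
  \<open>2 k\<close> consecutive factors from \<open>x - k + 1\<close> to \<open>x + k\<close>. At a
  natural number it is the coefficient occurring in \<open>V\<close>, so that \<open>V n x\<close>
  becomes the sum of \<open>W k n * W k x\<close>.\<close>

definition W :: "nat \<Rightarrow> rat \<Rightarrow> rat" where
  "W k x = (x gchoose k) * ((- 1 - x) gchoose k)"

text \<open>Partial product of Euler's product for sin(pi x) / (pi x). Up to the same constant as
  for \<open>W\<close>, \<open>x * P k x\<close> is the product of the \<open>2 k + 1\<close>
  factors from \<open>x - k\<close> to \<open>x + k\<close>.\<close>

definition P :: "nat \<Rightarrow> rat \<Rightarrow> rat" where
  "P k x = (\<Prod>i=1..k. 1 - x\<^sup>2 / of_nat i ^ 2)"

lemma W_0 [simp]: "W 0 x = 1"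
  by (simp add: W_def)

lemma P_0 [simp]: "P 0 x = 1"
  by (simp add: P_def)

lemma P_Suc: "P (Suc k) x = P k x * (1 - x\<^sup>2 / of_nat (Suc k) ^ 2)"
  by (simp add: P_def)

lemma W_Suc: "W (Suc k) x = W k x * ((of_nat k - x) * (of_nat k + 1 + x) / of_nat (Suc k) ^ 2)"
proof -
  have gbinomial: "(y gchoose Suc k) = (y gchoose k) * ((y - of_nat k) / of_nat (Suc k))" for y :: rat
    by (simp add: gbinomial_prod_rev divide_simps del: of_nat_Suc)
  have "W (Suc k) x = W k x * ((x - of_nat k) * (- 1 - x - of_nat k) / of_nat (Suc k) ^ 2)"
    unfolding W_def gbinomial by (simp add: power2_eq_square del: of_nat_Suc)
  also have "(x - of_nat k) * (- 1 - x - of_nat k) = (of_nat k - x) * (of_nat k + 1 + x)"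
    by (simp add: algebra_simps)
  finally show ?thesis .
qed

text \<open>The factor \<open>x - k\<close> completes the product \<open>W k x\<close> to a
  symmetric one. For \<open>W k (x - 1)\<close>, in the next lemma, the missing factor is
  \<open>x + k\<close>.\<close>

lemma P_eq_W: "x * P k x = (x - of_nat k) * W k x"
proof (induction k)
  case (Suc k)
  define s :: rat where "s = of_nat (Suc k)"
  have s: "s \<noteq> 0" "of_nat k = s - 1"
    by (simp_all add: s_def del: of_nat_Suc)
  have "x * P (Suc k) x = (x * P k x) * (1 - x\<^sup>2 / s\<^sup>2)"
    by (simp add: P_Suc s_def)
  also have "\<dots> = (x - (s - 1)) * W k x * (1 - x\<^sup>2 / s\<^sup>2)"
    by (simp only: Suc.IH s(2))
  also have "\<dots> = (x - s) * (W k x * ((s - 1 - x) * (s + x) / s\<^sup>2))"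
    using s(1) by (simp add: field_simps power2_eq_square)
  also have "\<dots> = (x - s) * W (Suc k) x"
    using s(2) by (simp add: W_Suc s_def)
  finally show ?case
    by (simp add: s_def)
qed simp

lemma P_eq_W_minus_1: "x * P k x = (x + of_nat k) * W k (x - 1)"
proof (induction k)
  case (Suc k)
  define s :: rat where "s = of_nat (Suc k)"
  have s: "s \<noteq> 0" "of_nat k = s - 1"
    by (simp_all add: s_def del: of_nat_Suc)
  have "x * P (Suc k) x = (x * P k x) * (1 - x\<^sup>2 / s\<^sup>2)"
    by (simp add: P_Suc s_def)
  also have "\<dots> = (x + (s - 1)) * W k (x - 1) * (1 - x\<^sup>2 / s\<^sup>2)"
    by (simp only: Suc.IH s(2))
  also have "\<dots> = (x + s) * (W k (x - 1) * ((s - 1 - (x - 1)) * (s + (x - 1)) / s\<^sup>2))"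
    using s(1) by (simp add: field_simps power2_eq_square)
  also have "\<dots> = (x + s) * W (Suc k) (x - 1)"
    using s(2) by (simp add: W_Suc s_def)
  finally show ?case
    by (simp add: s_def)
qed simp

text \<open>The right-hand side is \<open>2 * (P (Suc k) x - P k x)\<close>, which prepares an Abel
  summation. Both terms on the left are multiples of \<open>x * P k x\<close>, with factors
  \<open>- (s + x) / s^2\<close> and \<open>(s - x) / s^2\<close> for
  \<open>s = Suc k\<close>.\<close>

lemma W_add_W_minus_1: "W (Suc k) x + W (Suc k) (x - 1) = - 2 * x\<^sup>2 * P k x / of_nat (Suc k) ^ 2"
proof -
  define s :: rat where "s = of_nat (Suc k)"
  have s: "s \<noteq> 0" "of_nat k = s - 1"
    by (simp_all add: s_def del: of_nat_Suc)
  have "W (Suc k) x = - ((x - of_nat k) * W k x) * (s + x) / s\<^sup>2"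
    unfolding W_Suc s_def[symmetric] s(2) using s(1) by (simp add: divide_simps) (simp add: algebra_simps)
  moreover have "W (Suc k) (x - 1) = ((x + of_nat k) * W k (x - 1)) * (s - x) / s\<^sup>2"
    unfolding W_Suc s_def[symmetric] s(2) using s(1) by (simp add: divide_simps)
  ultimately have "W (Suc k) x + W (Suc k) (x - 1) = (x * P k x) * (s - x) / s\<^sup>2 - (x * P k x) * (s + x) / s\<^sup>2"
    by (simp flip: P_eq_W P_eq_W_minus_1)
  also have "\<dots> = - 2 * x\<^sup>2 * P k x / s\<^sup>2"
    using s(1) by (simp add: field_simps power2_eq_square)
  finally show ?thesis
    by (simp add: s_def)
qed

lemma sum_P_telescope: "x\<^sup>2 * (\<Sum>k<n. P k x / of_nat (Suc k) ^ 2) = 1 - P n x"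
  by (induction n) (simp_all add: P_Suc algebra_simps del: of_nat_Suc)

text \<open>Abel summation: \<open>W k x + W k (x - 1)\<close> is twice a difference of consecutive
  \<open>P k x\<close>, and the differences of \<open>P k y\<close> supply the factor
  \<open>y^2\<close>. For \<open>y = p\<close> the remaining sum is therefore needed only modulo
  \<open>p\<close>.\<close>

lemma sum_P_mult_W:
  "(\<Sum>k\<le>n. P k y * (W k x + W k (x - 1))) =
    2 * (P n y * P n x + y\<^sup>2 * (\<Sum>k<n. P k x * P k y / of_nat (Suc k) ^ 2))"
proof (induction n)
  case (Suc n)
  define s :: rat where "s = of_nat (Suc n)"
  have "(\<Sum>k\<le>Suc n. P k y * (W k x + W k (x - 1))) =
     2 * (P n y * P n x + y\<^sup>2 * (\<Sum>k<n. P k x * P k y / of_nat (Suc k) ^ 2))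
     + P n y * (1 - y\<^sup>2 / s\<^sup>2) * (- 2 * x\<^sup>2 * P n x / s\<^sup>2)"
    by (simp only: sum.atMost_Suc Suc.IH W_add_W_minus_1 P_Suc flip: s_def)
  also have "\<dots> = 2 * (P n y * (1 - y\<^sup>2 / s\<^sup>2) * (P n x * (1 - x\<^sup>2 / s\<^sup>2)) +
      y\<^sup>2 * (\<Sum>k<n. P k x * P k y / of_nat (Suc k) ^ 2) + y\<^sup>2 * (P n x * P n y / s\<^sup>2))"
    by (simp add: algebra_simps add_divide_distrib diff_divide_distrib)
  finally show ?case
    by (simp add: P_Suc s_def algebra_simps del: of_nat_Suc)
qed simp

lemma binomial_mult_binomial:
  "of_nat (n choose k) * of_nat ((n + k) choose k) * (- 1) ^ k = W k (of_nat n)"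
proof -
  have "(- 1 - of_nat n gchoose k) = (- 1) ^ k * (of_nat ((n + k) choose k) :: rat)"
    using gbinomial_minus[of "of_nat (n + 1) :: rat" k]
    by (simp add: binomial_gbinomial add.commute)
  then show ?thesis
    by (simp add: W_def binomial_gbinomial)
qed

text \<open>The sum telescopes: \<open>(n + 1) * P k (n + 1)\<close> and \<open>n * P k n\<close>
  are \<open>n + 1 + k\<close> and \<open>n - k\<close> times \<open>W k n\<close>, and these
  factors differ by \<open>2 k + 1\<close>.\<close>

lemma sum_W_of_nat: "(\<Sum>n<m. W k (of_nat n)) = of_nat m / (2 * of_nat k + 1) * P k (of_nat m)"
proof (induction m)
  case (Suc m)
  have "(of_nat m + 1) * P k (of_nat m + 1) - of_nat m * P k (of_nat m)
      = (2 * of_nat k + 1) * W k (of_nat m)"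
    using P_eq_W[of "of_nat m" k] P_eq_W_minus_1[of "of_nat m + 1" k] by (simp add: algebra_simps)
  moreover have "2 * of_nat k + 1 \<noteq> (0 :: rat)"
    by (metis of_nat_Suc of_nat_mult of_nat_numeral of_nat_neq_0 add.commute)
  ultimately show ?case
    by (simp add: Suc.IH field_simps)
qed simp

text \<open>Since \<open>W k n\<close> vanishes for \<open>k > n\<close>, all \<open>V n x\<close>
  with \<open>n < m\<close> share one range of \<open>k\<close>, and the two summations can be
  exchanged.\<close>

lemma V_eq_sum_W: "n < m \<Longrightarrow> V n x = (\<Sum>k<m. W k (of_nat n) * W k x)"
proof -
  assume "n < m"
  have "V n x = (\<Sum>k=0..n. W k (of_nat n) * W k x)"
    unfolding V_def binomial_mult_binomial by (simp add: W_def mult.assoc)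
  also have "\<dots> = (\<Sum>k<m. W k (of_nat n) * W k x)"
    using \<open>n < m\<close> by (intro sum.mono_neutral_left) (auto simp: binomial_eq_0 simp flip: binomial_mult_binomial)
  finally show ?thesis .
qed

lemma sum_V_eq:
  "(\<Sum>n<m. V n x) = of_nat m * (\<Sum>k<m. P k (of_nat m) * W k x / (2 * of_nat k + 1))"
proof -
  have "(\<Sum>n<m. V n x) = (\<Sum>n<m. \<Sum>k<m. W k (of_nat n) * W k x)"
    by (intro sum.cong) (auto intro: V_eq_sum_W)
  also have "\<dots> = (\<Sum>k<m. (\<Sum>n<m. W k (of_nat n)) * W k x)"
    by (subst sum.swap) (simp add: sum_distrib_right)
  finally show ?thesis
    by (simp add: sum_W_of_nat sum_distrib_left mult.assoc)
qed

text \<open>It is applied with \<open>Suc m = p\<close>. In \<open>sum_V_eq\<close> one denominator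
  \<open>2 k + 1\<close> then equals \<open>p\<close>, which prevents a direct reduction; the
  weights \<open>2 x + 1\<close> and \<open>2 x - 1\<close> are chosen to cancel all these
  denominators.\<close>

lemma sum_V_recurrence:
  "(2 * x + 1) * (\<Sum>n<Suc m. V n x) - (2 * x - 1) * (\<Sum>n<Suc m. V n (x - 1)) =
    2 * of_nat (Suc m) * (P m (of_nat (Suc m)) * P m x
      + of_nat (Suc m) ^ 2 * (\<Sum>k<m. P k x * P k (of_nat (Suc m)) / of_nat (Suc k) ^ 2))"
proof -
  have "(2 * x + 1) * (W k x / (2 * of_nat k + 1)) - (2 * x - 1) * (W k (x - 1) / (2 * of_nat k + 1))
      = W k x + W k (x - 1)" for k
  proof -
    have "2 * of_nat k + 1 \<noteq> (0 :: rat)"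
      by (metis of_nat_Suc of_nat_mult of_nat_numeral of_nat_neq_0 add.commute)
    moreover have "(x - of_nat k) * W k x = (x + of_nat k) * W k (x - 1)"
      by (simp flip: P_eq_W P_eq_W_minus_1)
    \<comment> \<open>The identity splits off a multiple of \<open>2 k + 1\<close>; what remains is
      zero by the preceding fact.\<close>
    moreover have "(2 * x + 1) * W k x - (2 * x - 1) * W k (x - 1) = (2 * of_nat k + 1) * (W k x + W k (x - 1))
        + 2 * ((x - of_nat k) * W k x - (x + of_nat k) * W k (x - 1))"
      by (simp add: algebra_simps)
    ultimately show ?thesis
      by (simp only: times_divide_eq_right diff_divide_distrib[symmetric] nonzero_mult_div_cancel_left diff_self mult_zero_right add_0_right simp_thms)
  qed
  then have "(2 * x + 1) * (P k y * W k x / (2 * of_nat k + 1))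
      - (2 * x - 1) * (P k y * W k (x - 1) / (2 * of_nat k + 1)) = P k y * (W k x + W k (x - 1))" for k y
    by (simp only: times_divide_eq_right[symmetric] mult.left_commute[of _ "P k y"] right_diff_distrib[symmetric])
  then have "(2 * x + 1) * (\<Sum>n<Suc m. V n x) - (2 * x - 1) * (\<Sum>n<Suc m. V n (x - 1))
      = of_nat (Suc m) * (\<Sum>k\<le>m. P k (of_nat (Suc m)) * (W k x + W k (x - 1)))"
    unfolding sum_V_eq mult.left_commute[of _ "of_nat (Suc m)"] right_diff_distrib[symmetric]
    by (simp only: sum_distrib_left lessThan_Suc_atMost flip: sum_subtractf)
  then show ?thesis
    by (simp only: sum_P_mult_W mult_ac)
qed

section \<open>Reduction of W, P and the sum modulo powers of p\<close>

lemma Zp_cong_W: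
  assumes "prime p" and "k < p" and "Zp_cong p j x y"
  shows "Zp_cong p j (W k x) (W k y)"
  using assms(2)
proof (induction k)
  case (Suc k)
  then show ?case
    unfolding W_Suc power2_eq_square divide_divide_eq_left[symmetric]
    by (intro Zp_cong_mult Zp_cong_divide_of_nat Zp_cong_diff Zp_cong_add Zp_cong_refl assms(1,3)) auto
qed simp

lemma Zp_cong_P:
  assumes "prime p" and "k < p" and "Zp_cong p j x y"
  shows "Zp_cong p j (P k x) (P k y)"
  using assms(2)
proof (induction k)
  case (Suc k)
  then show ?case
    unfolding P_Suc power2_eq_square divide_divide_eq_left[symmetric]
    by (intro Zp_cong_mult Zp_cong_divide_of_nat Zp_cong_diff Zp_cong_refl assms(1,3)) auto
qed simp

lemma Zp_P [simp]: "prime p \<Longrightarrow> k < p \<Longrightarrow> x \<in> Zp p \<Longrightarrow> P k x \<in> Zp p"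
  using Zp_cong_P[of p k 0 x x] Zp_congD(1) Zp_cong_refl by blast

text \<open>Only \<open>W k\<close> with \<open>k < p\<close> occur, and these involve no division
  by \<open>p\<close>.\<close>

lemma Zp_cong_sum_V:
  assumes "prime p" and "Zp_cong p j x y"
  shows "Zp_cong p j (\<Sum>n<p. V n x) (\<Sum>n<p. V n y)"
proof (rule Zp_cong_sum)
  fix n assume "n \<in> {..<p}"
  then show "Zp_cong p j (V n x) (V n y)"
    using assms by (auto simp: V_eq_sum_W[of n p] intro!: Zp_cong_sum Zp_cong_mult Zp_cong_W)
qed

definition H2 :: "nat \<Rightarrow> rat" where
  "H2 n = (\<Sum>j<n. 1 / of_nat (Suc j) ^ 2)"

lemma H2_0 [simp]: "H2 0 = 0"
  by (simp add: H2_def)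

lemma H2_Suc: "H2 (Suc n) = H2 n + 1 / of_nat (Suc n) ^ 2"
  by (simp add: H2_def)

lemma Zp_inverse_square: "prime p \<Longrightarrow> 0 < j \<Longrightarrow> j < p \<Longrightarrow> 1 / of_nat j ^ 2 \<in> Zp p"
  by (simp add: Zp_inverse_of_nat divide_inverse flip: power_inverse)

lemma Zp_H2 [simp]: "prime p \<Longrightarrow> n < p \<Longrightarrow> H2 n \<in> Zp p"
  unfolding H2_def by (intro Zp_sum Zp_inverse_square) auto

text \<open>Expanding the product, every term beyond those linear in the \<open>1 / i^2\<close>
  carries \<open>p ^ 4\<close>.\<close>

lemma P_multiple:
  assumes "prime p" and "n < p" and "t \<in> Zp p"
  shows "Zp_cong p 3 (P n (of_nat p * t)) (1 - of_nat p ^ 2 * t\<^sup>2 * H2 n)"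
  using assms(2)
proof (induction n)
  case (Suc n)
  define q :: rat where "q = of_nat p"
  define s :: rat where "s = 1 / of_nat (Suc n) ^ 2"
  have s: "s \<in> Zp p"
    unfolding s_def using assms(1) Suc.prems by (intro Zp_inverse_square) auto
  have "Zp_cong p 3 (P n (q * t) * (1 - q\<^sup>2 * t\<^sup>2 * s)) ((1 - q ^ 2 * t\<^sup>2 * H2 n) * (1 - q\<^sup>2 * t\<^sup>2 * s))"
    using Suc s assms(3) by (intro Zp_cong_mult) (auto simp: q_def)
  also have "Zp_cong p 3 \<dots> (1 - q ^ 2 * t\<^sup>2 * (H2 n + s))"
    using Suc.prems s assms(1,3)
    by (intro Zp_congI[where c = "q * t ^ 4 * H2 n * s"]) (auto simp: q_def algebra_simps power_numeral_reduce)
  finally show ?case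
    by (simp add: P_Suc H2_Suc q_def s_def power_mult_distrib)
qed simp

section \<open>Bernoulli polynomials\<close>

text \<open>The series \<open>c t / (exp (c t) - 1)\<close>. With the scale \<open>c\<close>, the
  generating function of \<open>c ^ n * bernpoly n (a / c)\<close> has numerator
  \<open>exp (a t)\<close>, so that identities between values at rational points become polynomial
  identities in \<open>exp t\<close>.\<close>

definition bernoulli_fps :: "rat \<Rightarrow> rat fps" where
  "bernoulli_fps c = Abs_fps (\<lambda>n. c ^ n * bernoulli n / fact n)"

lemma bernoulli_fps_scale: "bernoulli_fps c = bernoulli_fps 1 oo (fps_const c * fps_X)"
  by (simp add: fps_eq_iff bernoulli_fps_def fps_compose_linear)

lemma bernoulli_fps_1_mult: "bernoulli_fps 1 * (fps_exp 1 - 1) = fps_X"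
proof (rule fps_ext)
  fix n
  have "(bernoulli_fps 1 * (fps_exp 1 - 1)) $ n
      = (\<Sum>k=0..n. bernoulli k / fact k * (if k = n then 0 else 1 / fact (n - k)))"
    unfolding fps_mult_nth by (intro sum.cong) (auto simp: bernoulli_fps_def)
  also have "\<dots> = (\<Sum>k<n. bernoulli k / fact k * (1 / fact (n - k)))"
    by (intro sum.mono_neutral_cong_right) auto
  also have "\<dots> = (\<Sum>k<n. of_nat (n choose k) * bernoulli k) / fact n"
    by (simp add: sum_divide_distrib binomial_fact)
  also have "\<dots> = fps_X $ n"
  proof (cases "n < 2")
    case True
    then have "n = 0 \<or> n = 1"
      by auto
    then show ?thesis
      by (auto simp: bernoulli_0)
  next
    case False
    then have "{..<n} = {0..n - 1}"
      by auto
    with False show ?thesis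
      using bernoulli_recurrence[of n] by simp
  qed
  finally show "(bernoulli_fps 1 * (fps_exp 1 - 1)) $ n = fps_X $ n" .
qed

lemma bernoulli_fps_mult: "bernoulli_fps c * (fps_exp c - 1) = fps_const c * fps_X"
proof -
  have "(bernoulli_fps 1 * (fps_exp 1 - 1)) oo (fps_const c * fps_X) = fps_const c * fps_X"
    by (simp add: bernoulli_fps_1_mult)
  then show ?thesis
    by (simp add: fps_compose_mult_distrib fps_compose_sub_distrib fps_exp_compose_linear flip: bernoulli_fps_scale)
qed

lemma bernoulli_fps_mult_exp_nth: "(bernoulli_fps c * fps_exp (c * x)) $ n = c ^ n * bernpoly n x / fact n"
proof -
  have "(bernoulli_fps c * fps_exp (c * x)) $ n
      = (\<Sum>k=0..n. c ^ n * (of_nat (n choose k) * bernoulli k * x ^ (n - k)) / fact n)"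
    unfolding fps_mult_nth
  proof (intro sum.cong refl)
    fix k assume "k \<in> {0..n}"
    then have "c ^ n = c ^ k * c ^ (n - k)" "of_nat (n choose k) = (fact n / (fact k * fact (n - k)) :: rat)"
      by (simp_all add: binomial_fact flip: power_add)
    then show "bernoulli_fps c $ k * fps_exp (c * x) $ (n - k)
        = c ^ n * (of_nat (n choose k) * bernoulli k * x ^ (n - k)) / fact n"
      by (simp add: bernoulli_fps_def power_mult_distrib)
  qed
  then show ?thesis
    by (simp add: bernpoly_def sum_distrib_left sum_divide_distrib)
qed

lemma fps_exp_neq_1: "c \<noteq> 0 \<Longrightarrow> fps_exp c - 1 \<noteq> (0 :: rat fps)"
proof
  assume "c \<noteq> 0" "fps_exp c - 1 = (0 :: rat fps)"
  then have "(fps_exp c - 1 :: rat fps) $ 1 = 0"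
    by simp
  with \<open>c \<noteq> 0\<close> show False
    by simp
qed

lemma bernpoly_diff: "bernpoly (Suc n) (x + 1) - bernpoly (Suc n) x = of_nat (Suc n) * x ^ n"
proof -
  have "bernoulli_fps 1 * fps_exp (x + 1) - bernoulli_fps 1 * fps_exp x
      = (bernoulli_fps 1 * (fps_exp 1 - 1)) * fps_exp x"
    by (simp add: fps_exp_add_mult algebra_simps)
  then have "(bernoulli_fps 1 * fps_exp (x + 1)) $ Suc n - (bernoulli_fps 1 * fps_exp x) $ Suc n
      = (fps_X * fps_exp x) $ Suc n"
    by (simp add: bernoulli_fps_1_mult flip: fps_sub_nth)
  then have "bernpoly (Suc n) (x + 1) / fact (Suc n) - bernpoly (Suc n) x / fact (Suc n) = x ^ n / fact n"
    unfolding bernoulli_fps_mult_exp_nth[of 1, simplified] by simp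
  then have "bernpoly (Suc n) (x + 1) - bernpoly (Suc n) x = fact (Suc n) * (x ^ n / fact n)"
    by (simp add: diff_divide_distrib[symmetric] divide_eq_eq mult.commute del: fact_Suc)
  then show ?thesis
    by simp
qed

text \<open>The generating functions satisfy
  \<open>t exp t / (exp t - 1) = (- t) / (exp (- t) - 1)\<close>, obtained here by cancelling
  \<open>exp t - 1\<close>.\<close>

lemma bernpoly_reflect: "bernpoly n (1 - x) = (- 1) ^ n * bernpoly n x"
proof -
  have e: "fps_exp 1 * fps_exp (- 1) = (1 :: rat fps)"
    by (simp flip: fps_exp_add_mult)
  have "bernoulli_fps 1 * fps_exp 1 * (fps_exp 1 - 1) = fps_X * fps_exp 1"
    using bernoulli_fps_1_mult by (metis mult.assoc mult.commute)
  also have "\<dots> = - (bernoulli_fps (- 1) * (fps_exp (- 1) - 1)) * fps_exp 1"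
    by (simp add: bernoulli_fps_mult flip: fps_const_neg)
  also have "\<dots> = bernoulli_fps (- 1) * (fps_exp 1 - 1)"
    using e by (simp add: algebra_simps)
  finally have "bernoulli_fps 1 * fps_exp 1 = bernoulli_fps (- 1)"
    using fps_exp_neq_1[of 1] by simp
  then have "bernoulli_fps 1 * fps_exp (1 * (1 - x)) = bernoulli_fps (- 1) * fps_exp (- 1 * x)"
    using fps_exp_add_mult[of 1 "- x"] by (simp flip: mult.assoc)
  then have "(bernoulli_fps 1 * fps_exp (1 * (1 - x))) $ n = (bernoulli_fps (- 1) * fps_exp (- 1 * x)) $ n"
    by simp
  then show ?thesis
    unfolding bernoulli_fps_mult_exp_nth by simp
qed

text \<open>The difference equation makes the two values equal, the reflection makes them
  opposite.\<close>

lemma bernpoly_odd_0: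
  assumes "odd n" and "n > 1"
  shows "bernpoly n 0 = 0" "bernpoly n 1 = 0"
proof -
  obtain m where "n = Suc m" "m > 0"
    using assms(2) by (cases n) auto
  then have "bernpoly n 1 = bernpoly n 0"
    using bernpoly_diff[of m 0] by (simp add: zero_power)
  moreover have "bernpoly n 1 = - bernpoly n 0"
    using bernpoly_reflect[of n 0] assms(1) by simp
  ultimately show "bernpoly n 0 = 0" "bernpoly n 1 = 0"
    by simp_all
qed

text \<open>The recurrence says that the exponential generating function is
  \<open>1 / (c cosh t + 1 - c)\<close>. The case \<open>c = 1\<close> gives the Euler numbers,
  \<open>c = 2\<close> the numbers \<open>U\<close>.\<close>

lemma even_recurrence_fps:
  fixes a :: "nat \<Rightarrow> rat"
  assumes a_0: "a 0 = 1" and a_odd: "\<And>n. odd n \<Longrightarrow> a n = 0"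
    and a_even: "\<And>n. n \<ge> 1 \<Longrightarrow> a (2 * n) = - c * (\<Sum>k=1..n. of_nat ((2 * n) choose (2 * k)) * a (2 * n - 2 * k))"
  shows "Abs_fps (\<lambda>n. a n / fact n) * (fps_const (c / 2) * (fps_exp 1 + fps_exp (- 1)) + fps_const (1 - c)) = 1"
    (is "?A * ?C = 1")
proof (rule fps_ext)
  fix n
  have C: "?C $ k = (if k = 0 then 1 else if odd k then 0 else c / fact k)" for k
    by (auto simp: minus_one_power_iff)
  show "(?A * ?C) $ n = 1 $ n"
  proof (cases "even n")
    case False
    have "a i / fact i * ?C $ (n - i) = 0" if "i \<le> n" for i
      using False that a_odd[of i] unfolding C by (cases "even i") auto
    then have "(?A * ?C) $ n = 0"
      unfolding fps_mult_nth by (intro sum.neutral) simp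
    with False show ?thesis
      by (cases n) auto
  next
    case True
    then obtain m where n: "n = 2 * m" ..
    have "(?A * ?C) $ n = (\<Sum>i=0..n. ?C $ i * (a (n - i) / fact (n - i)))"
      by (subst mult.commute) (simp add: fps_mult_nth)
    also have "\<dots> = (\<Sum>i\<in>(*) 2 ` {0..m}. ?C $ i * (a (n - i) / fact (n - i)))"
    proof (rule sum.mono_neutral_right)
      show "\<forall>i\<in>{0..n} - (*) 2 ` {0..m}. ?C $ i * (a (n - i) / fact (n - i)) = 0"
        unfolding C n by (auto elim!: evenE)
    qed (auto simp: n)
    also have "\<dots> = (\<Sum>k=0..m. ?C $ (2 * k) * (a (n - 2 * k) / fact (n - 2 * k)))"
      by (subst sum.reindex) (auto intro: inj_onI)
    also have "\<dots> = a n / fact n + (\<Sum>k=1..m. c / fact (2 * k) * (a (n - 2 * k) / fact (n - 2 * k)))"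
      unfolding C by (subst sum.atLeast_Suc_atMost) auto
    also have "(\<Sum>k=1..m. c / fact (2 * k) * (a (n - 2 * k) / fact (n - 2 * k)))
        = c * (\<Sum>k=1..m. of_nat (n choose (2 * k)) * a (n - 2 * k)) / fact n"
      by (simp add: sum_distrib_left sum_divide_distrib n binomial_fact mult_ac)
    also have "a n / fact n + \<dots> = 1 $ n"
      using a_even[of m] by (cases m) (auto simp: n a_0 add_divide_distrib[symmetric] simp del: mult_Suc_right)
    finally show ?thesis .
  qed
qed

lemma E_odd: "odd n \<Longrightarrow> E n = 0" and U_odd: "odd n \<Longrightarrow> U n = 0"
  by (simp_all add: E.simps[of n] U.simps[of n] odd_pos)

lemma E_fps: "Abs_fps (\<lambda>n. of_int (E n) / fact n) * (fps_exp 1 + fps_exp (- 1)) = (2 :: rat fps)"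
proof -
  let ?A = "Abs_fps (\<lambda>n. of_int (E n) / fact n) :: rat fps" and ?C = "fps_exp 1 + fps_exp (- 1) :: rat fps"
  have "?A * (fps_const (1 / 2) * ?C + fps_const (1 - 1)) = 1"
    by (rule even_recurrence_fps) (simp_all add: E_recurrence E_odd)
  then have "?A * (fps_const (1 / 2) * ?C) = 1"
    by simp
  then have "fps_const 2 * fps_const (1 / 2) * (?A * ?C) = 2"
    by (simp add: mult_ac numeral_fps_const del: fps_const_mult)
  then show ?thesis
    by simp
qed

lemma U_fps: "Abs_fps (\<lambda>n. of_int (U n) / fact n) * (fps_exp 1 + fps_exp (- 1) - 1) = (1 :: rat fps)"
proof -
  have "Abs_fps (\<lambda>n. of_int (U n) / fact n)
      * (fps_const (2 / 2) * (fps_exp 1 + fps_exp (- 1)) + fps_const (1 - 2)) = (1 :: rat fps)"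
    by (rule even_recurrence_fps) (simp_all add: U_recurrence U_odd)
  then show ?thesis
    by (simp flip: fps_const_neg)
qed


lemma fps_exp_power: "fps_exp (of_nat n) = (fps_exp 1 ^ n :: rat fps)"
  using fps_exp_power_mult[of "1 :: rat" n] by simp

lemma divide_fact_eq:
  fixes a b :: rat
  assumes "a / fact n = b / fact (n - 1)" and "n > 0"
  shows "a = of_nat n * b"
  using assms by (cases n) (simp_all add: divide_simps del: of_nat_Suc)

text \<open>With \<open>e = exp t\<close>, the point is that
  \<open>4 t (e - e^3) / (e^4 - 1) = - 4 t / (e + 1 / e)\<close>. The left side generates the
  difference of the values at 1/4 and 3/4, which reflection turns into twice the value at 1/4.
  Denominators are cleared and cancelled in the integral domain of power series.\<close>

lemma bernpoly_quarter:
  assumes "odd n"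
  shows "4 ^ n * bernpoly n (1 / 4) = - of_nat n * of_int (E (n - 1))"
proof -
  let ?A = "Abs_fps (\<lambda>n. of_int (E n) / fact n) :: rat fps"
  define e :: "rat fps" where "e = fps_exp 1"
  have pow: "fps_exp (numeral k) = e ^ numeral k" for k
    using fps_exp_power[of "numeral k"] by (simp add: e_def)
  have inv: "e * fps_exp (- 1) = 1"
    by (simp add: e_def flip: fps_exp_add_mult)
  have B: "bernoulli_fps 4 * (e ^ 4 - 1) = 4 * fps_X"
    using bernoulli_fps_mult[of 4] by (simp add: pow numeral_fps_const)
  have A: "?A * (e ^ 2 + 1) = 2 * e"
  proof -
    have "?A * (e ^ 2 + 1) = ?A * (e + fps_exp (- 1)) * e"
      using inv by (simp add: algebra_simps power2_eq_square)
    then show ?thesis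
      using E_fps by (simp add: e_def)
  qed
  have "(e ^ 4 - 1) * (e\<^sup>2 + 1) * (bernoulli_fps 4 * (e - e ^ 3)) = (e ^ 4 - 1) * (e\<^sup>2 + 1) * (- (2 * (fps_X * ?A)))"
  proof -
    have "(e ^ 4 - 1) * (e\<^sup>2 + 1) * (bernoulli_fps 4 * (e - e ^ 3)) = (bernoulli_fps 4 * (e ^ 4 - 1)) * ((e\<^sup>2 + 1) * (e - e ^ 3))"
      by (simp only: mult_ac)
    also have "\<dots> = 4 * fps_X * ((e\<^sup>2 + 1) * (e - e ^ 3))"
      unfolding B ..
    also have "\<dots> = (e ^ 4 - 1) * (- (2 * (fps_X * (2 * e))))"
      by (simp add: algebra_simps power_numeral_reduce)
    also have "\<dots> = (e ^ 4 - 1) * (e\<^sup>2 + 1) * (- (2 * (fps_X * ?A)))"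
      unfolding A[symmetric] by (simp only: mult_ac mult_minus_right)
    finally show ?thesis .
  qed
  moreover have "e ^ 4 - 1 \<noteq> 0" "e\<^sup>2 + 1 \<noteq> 0"
    using fps_exp_neq_1[of 4] A by (auto simp: pow e_def)
  then have "(e ^ 4 - 1) * (e\<^sup>2 + 1) \<noteq> 0"
    by (simp only: mult_eq_0_iff simp_thms)
  ultimately have "bernoulli_fps 4 * (e - e ^ 3) = - (2 * (fps_X * ?A))"
    by (simp only: mult_left_cancel not_False_eq_True)
  then have "(bernoulli_fps 4 * fps_exp (4 * (1 / 4)) - bernoulli_fps 4 * fps_exp (4 * (3 / 4))) $ n
      = (- (fps_const 2 * (fps_X * ?A))) $ n"
    by (simp add: pow e_def right_diff_distrib numeral_fps_const)
  then have *: "4 ^ n * bernpoly n (1 / 4) / fact n - 4 ^ n * bernpoly n (3 / 4) / fact n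
      = - (2 * (of_int (E (n - 1)) / fact (n - 1)))"
    unfolding fps_sub_nth bernoulli_fps_mult_exp_nth using odd_pos[OF assms] by simp
  define X where "X = 4 ^ n * bernpoly n (1 / 4)"
  have "4 ^ n * bernpoly n (3 / 4) = - X"
    using bernpoly_reflect[of n "1 / 4"] assms by (simp add: X_def)
  with * have "X / fact n - - X / fact n = - (2 * (of_int (E (n - 1)) / fact (n - 1)))"
    by (simp only: X_def)
  then have "2 * X / fact n = - 2 * of_int (E (n - 1)) / fact (n - 1)"
    by (simp only: diff_divide_distrib[symmetric] diff_minus_eq_add mult_2 mult_minus_left times_divide_eq_right minus_divide_left)
  from divide_fact_eq[OF this odd_pos[OF assms]] show ?thesis
    unfolding X_def by linarith
qed

text \<open>Two relations between Bernoulli series of scales 6 and 3. The first is the duplication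
  formula at 1/6 and 2/3; the second brings in \<open>U\<close> and, combined with the first,
  isolates the value at 1/3.\<close>

lemma bernpoly_sixth_third:
  assumes "odd n"
  shows "6 ^ n * bernpoly n (1 / 6) = (6 ^ n + 2 * 3 ^ n) * bernpoly n (1 / 3)"
    and "2 * 3 ^ n * (2 ^ n + 1) * bernpoly n (1 / 3) = - 3 * of_nat n * of_int (U (n - 1))"
proof -
  let ?A = "Abs_fps (\<lambda>n. of_int (U n) / fact n) :: rat fps"
  define e :: "rat fps" where "e = fps_exp 1"
  have pow: "fps_exp (numeral k) = e ^ numeral k" for k
    using fps_exp_power[of "numeral k"] by (simp add: e_def)
  have inv: "e * fps_exp (- 1) = 1"
    by (simp add: e_def flip: fps_exp_add_mult)
  have B6: "bernoulli_fps 6 * (e ^ 6 - 1) = 6 * fps_X" and B3: "bernoulli_fps 3 * (e ^ 3 - 1) = 3 * fps_X"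
    using bernoulli_fps_mult[of 6] bernoulli_fps_mult[of 3] by (simp_all add: pow numeral_fps_const)
  have e6: "e ^ 6 - 1 = (e ^ 3 - 1) * (e ^ 3 + 1)"
    by (simp add: algebra_simps flip: power_add)
  have nz: "e ^ 6 - 1 \<noteq> 0"
    using fps_exp_neq_1[of 6] by (simp add: pow)
  have A: "?A * (e ^ 2 - e + 1) = e"
  proof -
    have "?A * (e ^ 2 - e + 1) = ?A * (e + fps_exp (- 1) - 1) * e"
      using inv by (simp add: algebra_simps power2_eq_square)
    then show ?thesis
      using U_fps by (simp add: e_def)
  qed
  \<comment> \<open>Duplication: \<open>e + e^4 = e (e^3 + 1)\<close> cancels a factor of
    \<open>e^6 - 1\<close>.\<close>
  have "(e ^ 6 - 1) * (bernoulli_fps 6 * (e + e ^ 4)) = (e ^ 6 - 1) * (2 * (bernoulli_fps 3 * e))"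
  proof -
    have "(e ^ 6 - 1) * (bernoulli_fps 6 * (e + e ^ 4)) = (bernoulli_fps 6 * (e ^ 6 - 1)) * (e + e ^ 4)"
      by (simp only: mult_ac)
    also have "\<dots> = 6 * fps_X * (e + e ^ 4)"
      unfolding B6 ..
    also have "\<dots> = 3 * fps_X * (e ^ 3 + 1) * (2 * e)"
      by (simp add: algebra_simps power_numeral_reduce)
    also have "\<dots> = (e ^ 6 - 1) * (2 * (bernoulli_fps 3 * e))"
      unfolding B3[symmetric] e6 by (simp only: mult_ac)
    finally show ?thesis .
  qed
  with nz have "bernoulli_fps 6 * (e + e ^ 4) = 2 * (bernoulli_fps 3 * e)"
    by simp
  then have "(bernoulli_fps 6 * fps_exp (6 * (1 / 6)) + bernoulli_fps 6 * fps_exp (6 * (2 / 3))) $ n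
      = (fps_const 2 * (bernoulli_fps 3 * fps_exp (3 * (1 / 3)))) $ n"
    by (simp add: pow e_def distrib_left numeral_fps_const)
  then have "6 ^ n * bernpoly n (1 / 6) / fact n + 6 ^ n * bernpoly n (2 / 3) / fact n
      = 2 * (3 ^ n * bernpoly n (1 / 3) / fact n)"
    unfolding fps_add_nth fps_mult_left_const_nth bernoulli_fps_mult_exp_nth .
  moreover have reflect: "bernpoly n (2 / 3) = - bernpoly n (1 / 3)" "bernpoly n (5 / 6) = - bernpoly n (1 / 6)"
    using bernpoly_reflect[of n "1 / 3"] bernpoly_reflect[of n "1 / 6"] assms by simp_all
  ultimately show 1: "6 ^ n * bernpoly n (1 / 6) = (6 ^ n + 2 * 3 ^ n) * bernpoly n (1 / 3)"
    by (simp add: field_simps)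
  have factor: "(u * v) * w * (x * g - y * h) = w * ((x * (u * v)) * g - (y * u) * v * h)"
    for u v w x y g h :: "rat fps"
    by (simp add: algebra_simps)
  \<comment> \<open>Over the common denominator the numerator is
    \<open>- 3 t e (1 + e) (e^3 - 1)\<close>, and \<open>e^3 + 1 = (e + 1) (e^2 - e + 1)\<close>;
    the quotient is \<open>- 3 t / (e + 1 / e - 1)\<close>.\<close>
  have "(e ^ 6 - 1) * (e\<^sup>2 - e + 1) * (bernoulli_fps 6 * (e - e ^ 5) - bernoulli_fps 3 * (e - e\<^sup>2))
      = (e ^ 6 - 1) * (e\<^sup>2 - e + 1) * (- (3 * (fps_X * ?A)))"
  proof -
    have "(e ^ 6 - 1) * (e\<^sup>2 - e + 1) * (bernoulli_fps 6 * (e - e ^ 5) - bernoulli_fps 3 * (e - e\<^sup>2))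
        = (e\<^sup>2 - e + 1) * ((bernoulli_fps 6 * (e ^ 6 - 1)) * (e - e ^ 5)
            - (bernoulli_fps 3 * (e ^ 3 - 1)) * (e ^ 3 + 1) * (e - e\<^sup>2))"
      unfolding e6 by (rule factor)
    also have "\<dots> = (e\<^sup>2 - e + 1) * (6 * fps_X * (e - e ^ 5) - 3 * fps_X * (e ^ 3 + 1) * (e - e\<^sup>2))"
      unfolding B6 B3 ..
    also have "\<dots> = (e ^ 6 - 1) * (- (3 * (fps_X * e)))"
      by (simp add: algebra_simps power_numeral_reduce)
    also have "\<dots> = (e ^ 6 - 1) * (- (3 * (fps_X * (?A * (e\<^sup>2 - e + 1)))))"
      unfolding A ..
    also have "\<dots> = (e ^ 6 - 1) * (e\<^sup>2 - e + 1) * (- (3 * (fps_X * ?A)))"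
      by (simp only: mult_ac mult_minus_right)
    finally show ?thesis .
  qed
  moreover have "e\<^sup>2 - e + 1 \<noteq> 0"
    using A by (auto simp: e_def)
  then have "(e ^ 6 - 1) * (e\<^sup>2 - e + 1) \<noteq> 0"
    using nz by (simp only: mult_eq_0_iff simp_thms)
  ultimately have "bernoulli_fps 6 * (e - e ^ 5) - bernoulli_fps 3 * (e - e\<^sup>2) = - (3 * (fps_X * ?A))"
    by (simp only: mult_left_cancel not_False_eq_True)
  then have "(bernoulli_fps 6 * fps_exp (6 * (1 / 6)) - bernoulli_fps 6 * fps_exp (6 * (5 / 6))
      - (bernoulli_fps 3 * fps_exp (3 * (1 / 3)) - bernoulli_fps 3 * fps_exp (3 * (2 / 3)))) $ n
      = (- (fps_const 3 * (fps_X * ?A))) $ n"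
    by (simp add: pow e_def right_diff_distrib numeral_fps_const)
  then have "6 ^ n * bernpoly n (1 / 6) / fact n - 6 ^ n * bernpoly n (5 / 6) / fact n
      - (3 ^ n * bernpoly n (1 / 3) / fact n - 3 ^ n * bernpoly n (2 / 3) / fact n)
      = - (3 * (of_int (U (n - 1)) / fact (n - 1)))"
    unfolding fps_sub_nth bernoulli_fps_mult_exp_nth using odd_pos[OF assms] by simp
  then have "(2 * (6 ^ n * bernpoly n (1 / 6)) - 2 * (3 ^ n * bernpoly n (1 / 3))) / fact n
      = (- 3 * of_int (U (n - 1))) / fact (n - 1)"
    unfolding reflect by (simp add: diff_divide_distrib)
  then have "2 * (6 ^ n * bernpoly n (1 / 6)) - 2 * (3 ^ n * bernpoly n (1 / 3)) = of_nat n * (- 3 * of_int (U (n - 1)))"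
    using odd_pos[OF assms] by (rule divide_fact_eq)
  moreover have "(6 :: rat) ^ n = 3 ^ n * 2 ^ n"
    by (simp flip: power_mult_distrib)
  ultimately show "2 * 3 ^ n * (2 ^ n + 1) * bernpoly n (1 / 3) = - 3 * of_nat n * of_int (U (n - 1))"
    unfolding 1 by (simp add: algebra_simps)
qed

section \<open>Bernoulli polynomials modulo p\<close>

lemma Zp_cong_of_natI: "[a = b] (mod p) \<Longrightarrow> Zp_cong p 1 (of_nat a) (of_nat b)"
proof -
  assume "[a = b] (mod p)"
  then have "int p dvd int a - int b"
    by (simp add: cong_iff_dvd_diff flip: cong_int_iff)
  then obtain c where "int a - int b = int p * c" ..
  then have "(of_int (int a - int b) :: rat) = of_int (int p * c)"
    by (rule arg_cong)
  then show ?thesis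
    by (intro Zp_congI[where c = "of_int c"]) auto
qed

lemma Zp_fermat:
  assumes "prime p" and "0 < j" and "j < p"
  shows "Zp_cong p 1 (of_nat j ^ (p - 1)) 1"
  using Zp_cong_of_natI[OF fermat_theorem[OF assms(1)]] assms by (auto dest: nat_dvd_not_less)

lemma Zp_bernoulli: "prime p \<Longrightarrow> n + 1 < p \<Longrightarrow> bernoulli n \<in> Zp p"
proof (induction n rule: less_induct)
  case (less n)
  show ?case
  proof (cases "n = 0")
    case False
    have "- (\<Sum>k<n. of_nat ((n + 1) choose k) * bernoulli k) / of_nat (n + 1) \<in> Zp p"
      using less by (intro Zp_divide_of_nat Zp_uminus Zp_sum Zp_mult) auto
    with False show ?thesis
      by (subst bernoulli.simps) simp
  qed (simp add: bernoulli_0)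
qed

lemma Zp_cong_bernpoly:
  assumes "prime p" and "n + 1 < p" and "Zp_cong p j x y"
  shows "Zp_cong p j (bernpoly n x) (bernpoly n y)"
  unfolding bernpoly_def using assms
  by (intro Zp_cong_sum Zp_cong_mult Zp_cong_power Zp_cong_refl Zp_bernoulli Zp_mult) auto

text \<open>Going from \<open>r\<close> to \<open>s = r + 1\<close>, the difference equation
  subtracts \<open>(p - 2) * s ^ (p - 3)\<close>, which is congruent to \<open>- 2 / s^2\<close> by
  Fermat. The start is the vanishing of odd Bernoulli numbers, as \<open>p - 2 > 1\<close>.\<close>

lemma Zp_cong_bernpoly_H2:
  assumes "prime p" and "p > 3" and "r < p"
  shows "Zp_cong p 1 (bernpoly (p - 2) (- of_nat r)) (2 * H2 r)"
  using assms(3)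
proof (induction r)
  case 0
  have "odd p"
    using assms(1,2) prime_odd_nat by auto
  then show ?case
    using bernpoly_odd_0[of "p - 2"] assms(2) by simp
next
  case (Suc r)
  define s :: rat where "s = of_nat (Suc r)"
  have "odd p"
    using assms(1,2) prime_odd_nat by auto
  then have "even (p - 3)" "p - 2 = Suc (p - 3)" "p - 1 = (p - 3) + 2"
    using assms(2) by auto
  moreover have "- s + 1 = - of_nat r"
    by (simp add: s_def)
  ultimately have eq: "bernpoly (p - 2) (- s) = bernpoly (p - 2) (- of_nat r) - of_nat (p - 2) * s ^ (p - 3)"
    using bernpoly_diff[of "p - 3" "- s"] by (simp add: power_minus_even del: of_nat_Suc)
  have s: "1 / s ^ 2 \<in> Zp p" "s \<noteq> 0"
    using Zp_inverse_square[OF assms(1), of "Suc r"] Suc.prems by (simp_all add: s_def del: of_nat_Suc)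
  have "Zp_cong p 1 (s ^ (p - 1) * (1 / s ^ 2)) (1 * (1 / s ^ 2))"
    unfolding s_def using Suc.prems s(1)
    by (intro Zp_cong_mult Zp_fermat assms(1) Zp_cong_refl) (auto simp: s_def)
  then have pow: "Zp_cong p 1 (s ^ (p - 3)) (1 / s ^ 2)"
    using s(2) \<open>p - 1 = (p - 3) + 2\<close> by (simp add: power_add power2_eq_square)
  have "Zp_cong p 1 (of_nat (p - 2)) (- 2)"
    using assms(2) by (intro Zp_congI[where c = 1]) (auto simp: of_nat_diff)
  then have "Zp_cong p 1 (bernpoly (p - 2) (- s)) (2 * H2 r - (- 2) * (1 / s ^ 2))"
    unfolding eq using Suc by (intro Zp_cong_diff Zp_cong_mult[OF _ pow]) auto
  then show ?case
    by (simp add: s_def H2_Suc algebra_simps)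
qed

text \<open>Modulo \<open>p\<close> the argument \<open>- (p - 1)\<close> is 1, where the polynomial
  of odd degree \<open>p - 2\<close> vanishes.\<close>

lemma Zp_cong_H2:
  assumes "prime p" and "p > 3"
  shows "Zp_cong p 1 (H2 (p - 1)) 0"
proof -
  have "odd p"
    using assms prime_odd_nat by auto
  have "Zp_cong p 1 (2 * H2 (p - 1)) (bernpoly (p - 2) (- of_nat (p - 1)))"
    using assms by (intro Zp_cong_sym[OF Zp_cong_bernpoly_H2]) auto
  also have "Zp_cong p 1 \<dots> (bernpoly (p - 2) 1)"
    using assms by (intro Zp_cong_bernpoly Zp_congI[where c = "- 1"]) (auto simp: of_nat_diff)
  also have "bernpoly (p - 2) 1 = 2 * 0"
    using bernpoly_odd_0[of "p - 2"] assms(2) \<open>odd p\<close> by simp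
  finally show ?thesis
    by (rule Zp_cong_cancel) (use Zp_inverse_of_nat[of p 2] assms in auto)
qed

section \<open>The sum modulo \<open>p ^ 4\<close>\<close>

lemma Zp_cong_inverse:
  assumes "prime p" and "Zp_cong p 1 c d" and "inverse d \<in> Zp p" and "d \<noteq> 0"
  shows "c \<noteq> 0" "inverse c \<in> Zp p" "Zp_cong p 1 (inverse c) (inverse d)"
proof -
  have "\<not> Zp_cong p 1 c 0"
  proof
    assume "Zp_cong p 1 c 0"
    then have "Zp_cong p 1 (inverse d * d) (inverse d * 0)"
      using assms(2,3) by (intro Zp_cong_mult Zp_cong_refl) (auto intro: Zp_cong_sym Zp_cong_trans)
    then show False
      using Zp_cong_of_nat_eq[of p 1 0] assms(1,4) prime_gt_1_nat[of p] by simp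
  qed
  then show c: "c \<noteq> 0" "inverse c \<in> Zp p"
    using Zp_inverse[of p c] assms(1,2) by (auto dest: Zp_congD)
  have "Zp_cong p 1 (inverse c * inverse d * d) (inverse c * inverse d * c)"
    using assms(2,3) c(2) by (intro Zp_cong_mult Zp_cong_refl Zp_cong_sym[OF assms(2)]) auto
  then show "Zp_cong p 1 (inverse c) (inverse d)"
    using c(1) assms(4) by (simp add: field_simps)
qed

lemma Zp_cong_scale_square: "Zp_cong p 1 a b \<Longrightarrow> Zp_cong p 3 (of_nat p ^ 2 * a) (of_nat p ^ 2 * b)"
  using Zp_cong_scale[of p 1 a b 2] by simp

text \<open>Both sides equal \<open>(y - k) * (y + k + 1) * W k y\<close>.\<close>

lemma P_shift: "(y + 1) * (y - of_nat k) * P k (y + 1) = (y + of_nat (Suc k)) * y * P k y"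
proof -
  have "(y + 1) * (y - of_nat k) * P k (y + 1) = (y - of_nat k) * ((y + 1) * P k (y + 1))"
    by (simp only: mult_ac)
  also have "\<dots> = (y - of_nat k) * ((y + 1 + of_nat k) * W k y)"
    by (simp add: P_eq_W_minus_1)
  also have "\<dots> = (y + 1 + of_nat k) * ((y - of_nat k) * W k y)"
    by (simp only: mult_ac)
  finally show ?thesis
    by (simp add: add_ac mult.assoc flip: P_eq_W)
qed

text \<open>The difference in \<open>sum_V_recurrence\<close> for \<open>Suc m = p\<close>, divided
  by \<open>2 p\<close>. Because of this factor \<open>p\<close>, it is needed only modulo
  \<open>p ^ 3\<close>.\<close>

definition increment :: "nat \<Rightarrow> rat \<Rightarrow> rat" where
  "increment p x = P (p - 1) (of_nat p) * P (p - 1) x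
     + of_nat p ^ 2 * (\<Sum>k<p - 1. P k x * P k (of_nat p) / of_nat (Suc k) ^ 2)"

context
  fixes p :: nat
  assumes prime: "prime p" and p_gt_3: "p > 3"
begin

lemma p_cong_0: "Zp_cong p 1 (of_nat p) 0"
  by (rule Zp_congI[where c = 1]) auto

lemma P_pred_multiple:
  assumes "t \<in> Zp p"
  shows "Zp_cong p 3 (P (p - 1) (of_nat p * t)) 1"
proof -
  have "Zp_cong p 3 (P (p - 1) (of_nat p * t)) (1 - of_nat p ^ 2 * t\<^sup>2 * H2 (p - 1))"
    using P_multiple[OF prime _ assms] p_gt_3 by simp
  also have "Zp_cong p 3 (of_nat p ^ 2 * (t\<^sup>2 * H2 (p - 1))) (of_nat p ^ 2 * (t\<^sup>2 * 0))"
    using prime p_gt_3 assms by (intro Zp_cong_scale_square Zp_cong_mult Zp_cong_refl Zp_cong_H2) auto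
  from Zp_cong_diff[OF Zp_cong_refl[OF Zp_1] this]
  have "Zp_cong p 3 (1 - of_nat p ^ 2 * t\<^sup>2 * H2 (p - 1)) 1"
    by (simp add: mult.assoc)
  finally show ?thesis .
qed

context
  fixes t :: rat
  assumes t: "t \<in> Zp p"
begin

lemma p_mult_add_cong: "Zp_cong p 1 (of_nat p * t + of_nat r) (of_nat r)"
  using t by (intro Zp_congI[where c = t]) auto

text \<open>\<open>P_shift\<close> for \<open>k = p - 1\<close> expresses
  \<open>P (p - 1) (y + 1)\<close> as the given product divided by
  \<open>(y + 1) * (y + 1 - p)\<close>. The product is a multiple of \<open>p ^ 2\<close> modulo
  \<open>p ^ 3\<close>, so this divisor matters only modulo \<open>p\<close>, where it is the unit
  \<open>(r + 1)^2\<close>.\<close>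

lemma P_pred_Suc:
  assumes "Suc r < p" and "y = of_nat p * t + of_nat r"
    and "Zp_cong p 3 ((y + of_nat p) * y * P (p - 1) y) (of_nat p ^ 2 * (t * (t + 1)))"
  shows "Zp_cong p 3 (P (p - 1) (y + 1)) (of_nat p ^ 2 * (t * (t + 1) / of_nat (Suc r) ^ 2))"
proof -
  define c where "c = (y + 1) * (y - of_nat (p - 1))"
  define d :: rat where "d = of_nat (Suc r) ^ 2"
  have "Zp_cong p 1 (y + 1) (of_nat r + 1)"
    unfolding assms(2) by (intro Zp_cong_add p_mult_add_cong Zp_cong_refl Zp_1)
  then have "Zp_cong p 1 ((y + 1) * (y + 1 - of_nat p)) ((of_nat r + 1) * (of_nat r + 1 - 0))"
    by (intro Zp_cong_mult Zp_cong_diff p_cong_0)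
  also have "(y + 1) * (y + 1 - of_nat p) = c"
    using p_gt_3 by (simp add: c_def of_nat_diff algebra_simps)
  also have "(of_nat r + 1) * (of_nat r + 1 - 0) = d"
    by (simp add: d_def power2_eq_square add.commute)
  finally have cd: "Zp_cong p 1 c d" .
  have d: "inverse d \<in> Zp p" "d \<noteq> 0"
    using Zp_inverse_square[OF prime, of "Suc r"] assms(1) by (simp_all add: d_def inverse_eq_divide del: of_nat_Suc)
  note c = Zp_cong_inverse[OF prime cd d]
  have "c * P (p - 1) (y + 1) = (y + of_nat p) * y * P (p - 1) y"
    using P_shift[of y "p - 1"] p_gt_3 by (simp add: c_def)
  then have "Zp_cong p 3 (c * P (p - 1) (y + 1)) (of_nat p ^ 2 * (t * (t + 1)))"
    using assms(3) by simp
  then have "Zp_cong p 3 (inverse c * (c * P (p - 1) (y + 1))) (inverse c * (of_nat p ^ 2 * (t * (t + 1))))"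
    by (rule Zp_cong_mult[OF Zp_cong_refl[OF c(2)]])
  moreover have "inverse c * (c * P (p - 1) (y + 1)) = P (p - 1) (y + 1)"
    using c(1) by simp
  moreover have "inverse c * (of_nat p ^ 2 * (t * (t + 1))) = of_nat p ^ 2 * (inverse c * (t * (t + 1)))"
    by (simp only: mult.left_commute)
  ultimately have "Zp_cong p 3 (P (p - 1) (y + 1)) (of_nat p ^ 2 * (inverse c * (t * (t + 1))))"
    by (simp only:)
  also have "Zp_cong p 3 \<dots> (of_nat p ^ 2 * (inverse d * (t * (t + 1))))"
    using c(3) t by (intro Zp_cong_scale_square Zp_cong_mult) auto
  finally show ?thesis
    by (simp add: d_def divide_inverse mult_ac)
qed

text \<open>The factor \<open>(y + p) * y\<close> makes one formula cover \<open>r = 0\<close> as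
  well: there it is exactly \<open>p ^ 2 * t * (t + 1)\<close>, and \<open>P (p - 1) (p * t)\<close>
  is congruent to 1. For \<open>r > 0\<close> it is congruent to \<open>r^2\<close> modulo
  \<open>p\<close>.\<close>

lemma P_pred_mult_cong:
  assumes "r < p" and "y = of_nat p * t + of_nat r"
  shows "Zp_cong p 3 ((y + of_nat p) * y * P (p - 1) y) (of_nat p ^ 2 * (t * (t + 1)))"
  using assms
proof (induction r arbitrary: y)
  case 0
  have "Zp_cong p 3 (of_nat p ^ 2 * (t * (t + 1)) * P (p - 1) (of_nat p * t)) (of_nat p ^ 2 * (t * (t + 1)) * 1)"
    using t by (intro Zp_cong_mult Zp_cong_refl P_pred_multiple) auto
  with 0 show ?case
    by (simp add: algebra_simps power2_eq_square)
next
  case (Suc r)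
  define s :: rat where "s = of_nat (Suc r) ^ 2"
  have s: "1 / s \<in> Zp p" "s \<noteq> 0"
    using Zp_inverse_square[OF prime, of "Suc r"] Suc.prems by (simp_all add: s_def del: of_nat_Suc)
  have y: "y \<in> Zp p"
    using t Suc.prems by simp
  have "Zp_cong p 3 (P (p - 1) (of_nat p * t + of_nat r + 1)) (of_nat p ^ 2 * (t * (t + 1) / s))"
    unfolding s_def using Suc by (intro P_pred_Suc) auto
  then have "Zp_cong p 3 (P (p - 1) y) (of_nat p ^ 2 * (t * (t + 1) / s))"
    using Suc.prems by (simp add: add_ac)
  then have "Zp_cong p 3 ((y + of_nat p) * y * P (p - 1) y) ((y + of_nat p) * y * (of_nat p ^ 2 * (t * (t + 1) / s)))"
    using y by (intro Zp_cong_mult Zp_cong_refl) auto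
  also have "\<dots> = of_nat p ^ 2 * ((y + of_nat p) * y * (t * (t + 1) * (1 / s)))"
    by simp
  also have "Zp_cong p 3 \<dots> (of_nat p ^ 2 * ((of_nat (Suc r) + 0) * of_nat (Suc r) * (t * (t + 1) * (1 / s))))"
    unfolding Suc.prems(2) using t s
    by (intro Zp_cong_scale_square Zp_cong_mult Zp_cong_add p_mult_add_cong p_cong_0 Zp_cong_refl Zp_mult Zp_add) auto
  also have "(of_nat (Suc r) + 0) * of_nat (Suc r) * (t * (t + 1) * (1 / s)) = t * (t + 1)"
    using s(2) unfolding s_def by (simp add: power2_eq_square del: of_nat_Suc)
  finally show ?case
    by simp
qed

lemma P_pred_cong:
  assumes "Suc r < p"
  shows "Zp_cong p 3 (P (p - 1) (of_nat p * t + of_nat (Suc r)))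
    (of_nat p ^ 2 * (t * (t + 1) / of_nat (Suc r) ^ 2))"
  using P_pred_Suc[OF assms refl P_pred_mult_cong] assms by (simp add: add_ac)

lemma P_P_sum_cong:
  assumes "x \<in> Zp p"
  shows "Zp_cong p 1 (\<Sum>k<p - 1. P k x * P k (of_nat p) / of_nat (Suc k) ^ 2)
    (\<Sum>k<p - 1. P k x / of_nat (Suc k) ^ 2)"
proof (rule Zp_cong_sum)
  fix k assume "k \<in> {..<p - 1}"
  then have k: "k < p" "Suc k < p"
    by auto
  have "P k 0 = 1" for k
    by (simp add: P_def)
  then have "Zp_cong p 1 (P k (of_nat p)) 1"
    using Zp_cong_P[OF prime k(1) p_cong_0] by simp
  then have "Zp_cong p 1 (P k x * P k (of_nat p) * (1 / of_nat (Suc k) ^ 2)) (P k x * 1 * (1 / of_nat (Suc k) ^ 2))"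
    using prime k assms by (intro Zp_cong_mult Zp_cong_refl Zp_inverse_square Zp_P) auto
  then show "Zp_cong p 1 (P k x * P k (of_nat p) / of_nat (Suc k) ^ 2) (P k x / of_nat (Suc k) ^ 2)"
    by simp
qed

text \<open>By \<open>sum_P_telescope\<close>, \<open>x^2\<close> times the sum is
  \<open>1 - P (p - 1) x\<close>, and \<open>P (p - 1) x\<close> vanishes modulo
  \<open>p\<close>.\<close>

lemma P_sum_cong:
  assumes "Suc r < p"
  shows "Zp_cong p 1 (\<Sum>k<p - 1. P k (of_nat p * t + of_nat (Suc r)) / of_nat (Suc k) ^ 2) (1 / of_nat (Suc r) ^ 2)"
proof -
  define x where "x = of_nat p * t + of_nat (Suc r)"
  define s :: rat where "s = of_nat (Suc r) ^ 2"
  define T where "T = (\<Sum>k<p - 1. P k x / of_nat (Suc k) ^ 2)"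
  have s: "1 / s \<in> Zp p" "s \<noteq> 0"
    using Zp_inverse_square[OF prime, of "Suc r"] assms by (simp_all add: s_def del: of_nat_Suc)
  have x: "x \<in> Zp p"
    using t by (simp add: x_def)
  have T: "T \<in> Zp p"
    unfolding T_def divide_inverse[of "P _ _"] using prime x
    by (intro Zp_sum Zp_mult Zp_P) (auto simp: Zp_inverse_of_nat simp flip: power_inverse simp del: of_nat_Suc)
  have "Zp_cong p 3 (P (p - 1) x) (of_nat p ^ 2 * (t * (t + 1) / s))"
    unfolding x_def s_def by (rule P_pred_cong) fact
  then have "Zp_cong p 1 (P (p - 1) x) (of_nat p ^ 2 * (t * (t + 1) / s))"
    by (rule Zp_cong_mono) simp
  also have "of_nat p ^ 2 * (t * (t + 1) / s) = of_nat p ^ 2 * (t * (t + 1) * (1 / s))"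
    by simp
  also have "Zp_cong p 1 \<dots> (0 ^ 2 * (t * (t + 1) * (1 / s)))"
    using s(1) t by (intro Zp_cong_mult Zp_cong_power p_cong_0 Zp_cong_refl) auto
  finally have P: "Zp_cong p 1 (P (p - 1) x) 0"
    by simp
  have "Zp_cong p 1 (s * T) (x\<^sup>2 * T)"
    unfolding s_def x_def power2_eq_square using T by (intro Zp_cong_mult Zp_cong_sym[OF p_mult_add_cong] Zp_cong_refl)
  also have "x\<^sup>2 * T = 1 - P (p - 1) x"
    unfolding T_def by (rule sum_P_telescope)
  also have "Zp_cong p 1 \<dots> (1 - 0)"
    using P by (intro Zp_cong_diff Zp_cong_refl) auto
  finally have "Zp_cong p 1 (1 / s * (s * T)) (1 / s * 1)"
    using s(1) by (intro Zp_cong_mult Zp_cong_refl) auto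
  then show ?thesis
    using s(2) by (simp add: s_def T_def x_def)
qed

text \<open>The term \<open>t * (t + 1)\<close> comes from the product of the two values of
  \<open>P\<close>, the added 1 from the sum.\<close>

lemma increment_Suc_cong:
  assumes "Suc r < p"
  shows "Zp_cong p 3 (increment p (of_nat p * t + of_nat (Suc r)))
    (of_nat p ^ 2 * ((t * (t + 1) + 1) / of_nat (Suc r) ^ 2))"
proof -
  define x where "x = of_nat p * t + of_nat (Suc r)"
  have x: "x \<in> Zp p"
    using t by (simp add: x_def)
  have 1: "Zp_cong p 3 (P (p - 1) (of_nat p)) 1"
    using P_pred_multiple[OF Zp_1] by simp
  have 2: "Zp_cong p 1 (\<Sum>k<p - 1. P k x * P k (of_nat p) / of_nat (Suc k) ^ 2) (1 / of_nat (Suc r) ^ 2)"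
    using P_P_sum_cong[OF x] P_sum_cong[OF assms] unfolding x_def by (rule Zp_cong_trans)
  have "Zp_cong p 3 (increment p x)
    (1 * (of_nat p ^ 2 * (t * (t + 1) / of_nat (Suc r) ^ 2)) + of_nat p ^ 2 * (1 / of_nat (Suc r) ^ 2))"
    unfolding increment_def
    by (intro Zp_cong_add Zp_cong_mult Zp_cong_scale_square 1 2 P_pred_cong[OF assms, folded x_def])
  then show ?thesis
    by (simp add: x_def algebra_simps add_divide_distrib)
qed

text \<open>At multiples of \<open>p\<close> the product is congruent to 1, while the sum reduces to
  \<open>H2 (p - 1)\<close>, which is zero modulo \<open>p\<close>.\<close>

lemma increment_multiple_cong: "Zp_cong p 3 (increment p (of_nat p * t)) 1"
proof -
  define x where "x = of_nat p * t"
  have x: "x \<in> Zp p" "Zp_cong p 1 x 0"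
    using t by (auto simp: x_def intro: Zp_congI[where c = t])
  have 1: "Zp_cong p 3 (P (p - 1) (of_nat p)) 1"
    using P_pred_multiple[OF Zp_1] by simp
  have "Zp_cong p 1 (P k x * (1 / of_nat (Suc k) ^ 2)) (P k 0 * (1 / of_nat (Suc k) ^ 2))" if "k < p - 1" for k
    using prime that x by (intro Zp_cong_mult Zp_cong_refl Zp_cong_P Zp_inverse_square) auto
  then have "Zp_cong p 1 (\<Sum>k<p - 1. P k x / of_nat (Suc k) ^ 2) (H2 (p - 1))"
    unfolding H2_def by (intro Zp_cong_sum) (simp add: P_def)
  with P_P_sum_cong[OF x(1)] have 2: "Zp_cong p 1 (\<Sum>k<p - 1. P k x * P k (of_nat p) / of_nat (Suc k) ^ 2) 0"
    using Zp_cong_H2[OF prime p_gt_3] by (blast intro: Zp_cong_trans)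
  have "Zp_cong p 3 (increment p x) (1 * 1 + of_nat p ^ 2 * 0)"
    unfolding increment_def
    by (intro Zp_cong_add Zp_cong_mult Zp_cong_scale_square 1 2 P_pred_multiple[OF t, folded x_def])
  then show ?thesis
    by (simp add: x_def)
qed

end

lemma sum_V_increment:
  "(2 * x + 1) * (\<Sum>n<p. V n x) = (2 * (x - 1) + 1) * (\<Sum>n<p. V n (x - 1)) + of_nat p * (2 * increment p x)"
  using sum_V_recurrence[of x "p - 1"] p_gt_3 by (simp add: increment_def algebra_simps)

lemma sum_V_0: "(\<Sum>n<p. V n 0) = (of_nat p :: rat)"
proof -
  have "W k 0 = 0" if "k > 0" for k
    using that by (cases k) (simp_all add: W_def)
  then have "V n 0 = (1 :: rat)" for n
    by (simp add: V_eq_sum_W[of n "Suc n"] sum.lessThan_Suc_shift del: sum.lessThan_Suc)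
  then show ?thesis
    by simp
qed

text \<open>The increments are added up from the value \<open>p\<close> at 0: an inner induction
  covers the residues \<open>r\<close>, an outer one moves from one multiple of \<open>p\<close> to
  the next.\<close>

lemma sum_V_of_nat_cong:
  assumes "r < p"
  shows "Zp_cong p 4 ((2 * of_nat (p * t + r) + 1) * (\<Sum>n<p. V n (of_nat (p * t + r))))
    (of_nat p * (1 + 2 * of_nat t) + 2 * of_nat p ^ 3 * ((of_nat t * (of_nat t + 1) + 1) * H2 r))"
proof -
  have scale: "Zp_cong p 4 (of_nat p * (2 * a)) (of_nat p * (2 * b))" if "Zp_cong p 3 a b" for a b
    using Zp_cong_scale[OF Zp_cong_mult[OF Zp_cong_refl[OF Zp_numeral] that], of 1 "num.Bit0 num.One"]
    by simp
  define F where "F t r = of_nat p * (1 + 2 * of_nat t) + 2 * of_nat p ^ 3 * ((of_nat t * (of_nat t + 1) + 1) * H2 r)" for t r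
  define G where "G x = (2 * x + 1) * (\<Sum>n<p. V n x)" for x :: rat
  have G: "G x = G (x - 1) + of_nat p * (2 * increment p x)" for x
    unfolding G_def by (rule sum_V_increment)
  have step_r: "Zp_cong p 4 (G (of_nat (p * t + r))) (F t r)"
    if "Zp_cong p 4 (G (of_nat (p * t))) (F t 0)" and "r < p" for t r
    using that(2)
  proof (induction r)
    case (Suc r)
    have "G (of_nat (p * t + Suc r)) = G (of_nat (p * t + r)) + of_nat p * (2 * increment p (of_nat p * of_nat t + of_nat (Suc r)))"
      by (subst G) (simp add: add_ac)
    also have "Zp_cong p 4 \<dots> (F t r + of_nat p * (2 * (of_nat p ^ 2 * ((of_nat t * (of_nat t + 1) + 1) / of_nat (Suc r) ^ 2))))"
      using Suc by (intro Zp_cong_add scale increment_Suc_cong) auto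
    also have "\<dots> = F t (Suc r)"
      by (simp add: F_def H2_Suc algebra_simps add_divide_distrib power_numeral_reduce del: of_nat_Suc)
    finally show ?case .
  qed (use that(1) in simp)
  have "Zp_cong p 4 (G (of_nat (p * t))) (F t 0)" for t
  proof (induction t)
    case 0
    then show ?case
      by (simp add: G_def F_def sum_V_0)
  next
    case (Suc t)
    \<comment> \<open>Over a full block the terms in \<open>H2\<close> disappear, so passing from
      \<open>p * t\<close> to \<open>p * (t + 1)\<close> adds just \<open>2 p\<close>.\<close>
    have "Zp_cong p (3 + 1) (of_nat p ^ 3 * (2 * (of_nat t * (of_nat t + 1) + 1) * H2 (p - 1)))
      (of_nat p ^ 3 * (2 * (of_nat t * (of_nat t + 1) + 1) * 0))"
      by (intro Zp_cong_scale Zp_cong_mult Zp_cong_refl Zp_cong_H2 prime p_gt_3) auto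
    then have "Zp_cong p 4 (F t 0 + of_nat p ^ 3 * (2 * (of_nat t * (of_nat t + 1) + 1) * H2 (p - 1))) (F t 0 + 0)"
      by (intro Zp_cong_add) (simp_all add: F_def)
    moreover have "F t 0 + of_nat p ^ 3 * (2 * (of_nat t * (of_nat t + 1) + 1) * H2 (p - 1)) = F t (p - 1)"
      by (simp add: F_def)
    ultimately have "Zp_cong p 4 (F t (p - 1)) (F t 0)"
      by simp
    with step_r[OF Suc.IH, of "p - 1"] have *: "Zp_cong p 4 (G (of_nat (p * t + (p - 1)))) (F t 0)"
      using p_gt_3 by (auto intro: Zp_cong_trans)
    have "of_nat (p * Suc t) - 1 = (of_nat (p * t + (p - 1)) :: rat)"
      using p_gt_3 by (simp add: of_nat_diff algebra_simps)
    then have "G (of_nat (p * Suc t)) = G (of_nat (p * t + (p - 1))) + of_nat p * (2 * increment p (of_nat p * of_nat (Suc t)))"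
      by (subst G) (simp del: of_nat_Suc mult_Suc_right)
    also have "Zp_cong p 4 \<dots> (F t 0 + of_nat p * (2 * 1))"
      by (intro Zp_cong_add scale increment_multiple_cong * Zp_of_nat)
    also have "\<dots> = F (Suc t) 0"
      by (simp add: F_def algebra_simps)
    finally show ?case .
  qed
  then show ?thesis
    using step_r[OF _ assms] by (simp add: F_def G_def)
qed

end

text \<open>Division by \<open>p\<close> costs one power of \<open>p\<close>: to know
  \<open>x'\<close> modulo \<open>p ^ k\<close>, \<open>x\<close> is approximated modulo
  \<open>p ^ Suc k\<close>.\<close>

lemma Zp_residue_split:
  assumes "prime p" and "x \<in> Zp p"
  obtains t r where "r < p" and "Zp_residue p x = r" and "Zp_cong p (Suc k) x (of_nat (p * t + r))"
    and "Zp_cong p k ((x - of_nat r) / of_nat p) (of_nat t)"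
proof -
  obtain n where n: "Zp_cong p (Suc k) x (of_nat n)"
    using Zp_cong_approximation[OF assms] .
  define r t where "r = n mod p" and "t = n div p"
  have p: "p > 0"
    using assms(1) prime_gt_0_nat by blast
  have ntr: "n = p * t + r" and "r < p"
    using p by (simp_all add: r_def t_def)
  obtain c where c: "c \<in> Zp p" "x = of_nat n + of_nat p ^ Suc k * c"
    using n Zp_congE by blast
  have "Zp_cong p 1 x (of_nat r)"
    using c assms(2) by (intro Zp_congI[where c = "of_nat t + of_nat p ^ k * c"]) (auto simp: ntr algebra_simps)
  then have "Zp_residue p x = r"
    using assms(1) \<open>r < p\<close> by (intro Zp_residue_eqI)
  moreover have eq: "(x - of_nat r) / of_nat p = of_nat t + of_nat p ^ k * c"
    using p c by (simp add: ntr field_simps)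
  then have "Zp_cong p k ((x - of_nat r) / of_nat p) (of_nat t)"
    unfolding eq using c by (intro Zp_congI[where c = c]) auto
  ultimately show ?thesis
    using that n \<open>r < p\<close> ntr by blast
qed

text \<open>Precision: \<open>x\<close> is needed modulo \<open>p ^ 4\<close>, \<open>x'\<close> in
  the first term modulo \<open>p ^ 3\<close>, and the factors of \<open>p ^ 3\<close> only modulo
  \<open>p\<close>. Keeping \<open>2 x + 1\<close> on the left allows approximation without
  inverting it.\<close>

lemma sum_V_mult_cong:
  assumes "prime p" and "p > 3" and "x \<in> Zp p" and "x' = (x - of_nat (Zp_residue p x)) / of_nat p"
  shows "Zp_cong p 4 ((2 * x + 1) * (\<Sum>n<p. V n x))
      ((1 + 2 * x') * of_nat p + (x' * (x' + 1) + 1) * of_nat p ^ 3 * bernpoly (p - 2) (- x))"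
proof -
  obtain t r where r: "r < p" "Zp_residue p x = r" and x: "Zp_cong p (Suc 3) x (of_nat (p * t + r))"
    and "Zp_cong p 3 ((x - of_nat r) / of_nat p) (of_nat t)"
    using Zp_residue_split[OF assms(1,3)] by metis
  then have x': "Zp_cong p 3 x' (of_nat t)"
    by (simp add: assms(4))
  have x4: "Zp_cong p 4 x (of_nat (p * t + r))"
    using x by simp
  have "Zp_cong p 4 ((2 * x + 1) * (\<Sum>n<p. V n x))
    ((2 * of_nat (p * t + r) + 1) * (\<Sum>n<p. V n (of_nat (p * t + r))))"
    by (intro Zp_cong_mult Zp_cong_add Zp_cong_sum_V assms(1) x4 Zp_cong_refl Zp_numeral Zp_1)
  also have "Zp_cong p 4 \<dots> (of_nat p * (1 + 2 * of_nat t) + 2 * of_nat p ^ 3 * ((of_nat t * (of_nat t + 1) + 1) * H2 r))"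
    by (rule sum_V_of_nat_cong) fact+
  also have "\<dots> = of_nat p ^ 1 * (1 + 2 * of_nat t) + of_nat p ^ 3 * ((of_nat t * (of_nat t + 1) + 1) * (2 * H2 r))"
    by simp
  also have "Zp_cong p 4 \<dots> (of_nat p ^ 1 * (1 + 2 * x') + of_nat p ^ 3 * ((x' * (x' + 1) + 1) * bernpoly (p - 2) (- x)))"
  proof (rule Zp_cong_add)
    have "Zp_cong p (1 + 3) (of_nat p ^ 1 * (1 + 2 * of_nat t)) (of_nat p ^ 1 * (1 + 2 * x'))"
      by (intro Zp_cong_scale Zp_cong_add Zp_cong_mult Zp_cong_sym[OF x'] Zp_cong_refl Zp_numeral Zp_1)
    then show "Zp_cong p 4 (of_nat p ^ 1 * (1 + 2 * of_nat t)) (of_nat p ^ 1 * (1 + 2 * x'))"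
      by simp
    have "Zp_cong p 1 (of_nat (p * t + r)) (of_nat r)"
      by (intro Zp_congI[where c = "of_nat t"]) auto
    with Zp_cong_mono[OF x4] have "Zp_cong p 1 x (of_nat r)"
      by (rule Zp_cong_trans) simp
    then have "Zp_cong p 1 (bernpoly (p - 2) (- x)) (bernpoly (p - 2) (- of_nat r))"
      using assms(1,2) by (intro Zp_cong_bernpoly Zp_cong_uminus) auto
    also have "Zp_cong p 1 \<dots> (2 * H2 r)"
      by (intro Zp_cong_bernpoly_H2 assms r)
    finally have B: "Zp_cong p 1 (2 * H2 r) (bernpoly (p - 2) (- x))"
      by (rule Zp_cong_sym)
    have "Zp_cong p 1 (of_nat t) x'"
      by (rule Zp_cong_sym[OF Zp_cong_mono[OF x']]) simp
    then have "Zp_cong p 1 (of_nat t * (of_nat t + 1) + 1) (x' * (x' + 1) + 1)"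
      by (intro Zp_cong_mult Zp_cong_add Zp_cong_refl Zp_1)
    from Zp_cong_scale[OF Zp_cong_mult[OF this B], of 3]
    show "Zp_cong p 4 (of_nat p ^ 3 * ((of_nat t * (of_nat t + 1) + 1) * (2 * H2 r)))
        (of_nat p ^ 3 * ((x' * (x' + 1) + 1) * bernpoly (p - 2) (- x)))"
      by simp
  qed
  finally show "Zp_cong p 4 ((2 * x + 1) * (\<Sum>n<p. V n x))
      ((1 + 2 * x') * of_nat p + (x' * (x' + 1) + 1) * of_nat p ^ 3 * bernpoly (p - 2) (- x))"
    by (simp add: mult_ac)
qed

lemma sum_V_cong:
  assumes "prime p" and "p > 3" and "x \<in> Zp p" and "\<not> Zp_cong p 1 (2 * x + 1) 0"
    and "x' = (x - of_nat (Zp_residue p x)) / of_nat p"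
  shows "Zp_cong p 4 (\<Sum>n<p. V n x) ((1 + 2 * x') / (1 + 2 * x) * of_nat p
       + (x' * (x' + 1) + 1) / (1 + 2 * x) * of_nat p ^ 3 * bernpoly (p - 2) (- x))"
proof (rule Zp_cong_cancel)
  show "inverse (2 * x + 1) \<in> Zp p"
    using assms by (intro Zp_inverse) auto
  show nz: "2 * x + 1 \<noteq> 0"
    using assms(4) by auto
  have cancel: "c * (a / c * u + b / c * v * w) = a * u + b * v * w" if "c \<noteq> 0" for a b c u v w :: rat
    using that by (simp add: field_simps)
  have "(2 * x + 1) * ((1 + 2 * x') / (1 + 2 * x) * of_nat p
       + (x' * (x' + 1) + 1) / (1 + 2 * x) * of_nat p ^ 3 * bernpoly (p - 2) (- x))
      = (1 + 2 * x') * of_nat p + (x' * (x' + 1) + 1) * of_nat p ^ 3 * bernpoly (p - 2) (- x)"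
    unfolding add.commute[of 1 "2 * x"] using nz by (rule cancel)
  then show "Zp_cong p 4 ((2 * x + 1) * (\<Sum>n<p. V n x)) ((2 * x + 1) * ((1 + 2 * x') / (1 + 2 * x) * of_nat p
       + (x' * (x' + 1) + 1) / (1 + 2 * x) * of_nat p ^ 3 * bernpoly (p - 2) (- x)))"
    using sum_V_mult_cong[OF assms(1-3,5)] by simp
qed

section \<open>The special values\<close>

lemma Zp_bernpoly: "prime p \<Longrightarrow> n + 1 < p \<Longrightarrow> x \<in> Zp p \<Longrightarrow> bernpoly n x \<in> Zp p"
  using Zp_cong_bernpoly[of p n 0 x x] Zp_congD(1) Zp_cong_refl by blast

context
  fixes p :: nat
  assumes prime: "prime p" and p_gt_3: "p > 3"
begin

text \<open>Needed for Fermat with base 4 and for \<open>d - 2 < p\<close> with \<open>d\<close> up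
  to 6.\<close>

lemma p_gt_4: "p > 4"
proof -
  have "p \<noteq> 4"
    using prime prime_odd_nat[of p] by auto
  with p_gt_3 show ?thesis
    by simp
qed

lemma p_odd: "odd p"
  using prime p_gt_3 prime_odd_nat by auto

lemma p_cases_6:
  obtains q where "p = 6 * q + 1" | q where "p = 6 * q + 5"
proof -
  have "p mod 6 = 1 \<or> p mod 6 = 5"
  proof (rule ccontr)
    assume *: "\<not> (p mod 6 = 1 \<or> p mod 6 = 5)"
    have "\<not> 3 dvd p"
      using prime p_gt_3 by (auto simp: prime_nat_iff)
    then have "p mod 3 \<noteq> 0" "p mod 2 \<noteq> 0"
      using p_odd by (auto simp: dvd_eq_mod_eq_0)
    with * show False
      by presburger
  qed
  then show ?thesis
    using that by (metis mult_div_mod_eq)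
qed

lemma coprime_6: "coprime 6 (int p)"
proof -
  have "\<not> 3 dvd p"
    using prime p_gt_3 by (auto simp: prime_nat_iff)
  then have "coprime 3 p"
    by (intro prime_imp_coprime) auto
  moreover have "coprime 2 p"
    using p_odd by simp
  ultimately have "coprime (2 * 3) p"
    by (simp only: coprime_mult_left_iff simp_thms)
  then have "coprime (int 6) (int p)"
    by (simp only: coprime_int_iff) simp
  then show ?thesis
    by simp
qed

lemma coprime_power_6: "d dvd 6 ^ k \<Longrightarrow> coprime d (int p)"
  by (rule coprime_divisors[OF _ dvd_refl]) (auto intro: coprime_6)

lemma Zp_fraction_6: "d \<noteq> 0 \<Longrightarrow> d dvd 6 ^ k \<Longrightarrow> of_int a / of_int d \<in> Zp p"
  by (intro Zp_fractionI coprime_power_6)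

lemma Zp_cong_cancel_6:
  assumes "Zp_cong p k (6 * a) (6 * b)"
  shows "Zp_cong p k a b"
  using Zp_fraction_6[of 6 1 1] by (intro Zp_cong_cancel[OF assms]) (auto simp: inverse_eq_divide)

lemma p_minus_2_cong: "Zp_cong p 1 (of_nat (p - 2)) (- 2)"
  using p_gt_3 by (intro Zp_congI[where c = 1]) (auto simp: of_nat_diff)

lemma Zp_fermat_2: "Zp_cong p 1 (2 ^ (p - 1)) 1" and Zp_fermat_3: "Zp_cong p 1 (3 ^ (p - 1)) 1"
  and Zp_fermat_4: "Zp_cong p 1 (4 ^ (p - 1)) 1" and Zp_fermat_6: "Zp_cong p 1 (6 ^ (p - 1)) 1"
proof -
  show 2: "Zp_cong p 1 (2 ^ (p - 1)) 1" and 3: "Zp_cong p 1 (3 ^ (p - 1)) 1"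
    and "Zp_cong p 1 (4 ^ (p - 1)) 1"
    using Zp_fermat[OF prime, of 2] Zp_fermat[OF prime, of 3] Zp_fermat[OF prime, of 4] p_gt_4 by simp_all
  from Zp_cong_mult[OF 2 3] show "Zp_cong p 1 (6 ^ (p - 1)) 1"
    by (simp flip: power_mult_distrib)
qed

lemma power_p_minus_1: "x ^ (p - 1) = x * x ^ (p - 2)"
proof -
  have "p - 1 = Suc (p - 2)"
    using p_gt_3 by simp
  then show ?thesis
    by simp
qed

lemma odd_p_minus_2: "odd (p - 2)"
  using p_odd p_gt_3 by simp

lemma bernpoly_quarter_cong: "Zp_cong p 1 (bernpoly (p - 2) (1 / 4)) (8 * of_int (E (p - 3)))"
proof -
  have "bernpoly (p - 2) (1 / 4) \<in> Zp p"
    using prime p_gt_3 Zp_fraction_6[of 4 2 1] by (intro Zp_bernpoly) auto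
  from Zp_cong_mult[OF Zp_cong_sym[OF Zp_fermat_4] Zp_cong_refl[OF this]]
  have "Zp_cong p 1 (bernpoly (p - 2) (1 / 4)) (4 ^ (p - 1) * bernpoly (p - 2) (1 / 4))"
    by simp
  also have "4 ^ (p - 1) * bernpoly (p - 2) (1 / 4) = - 4 * of_int (E (p - 3)) * of_nat (p - 2)"
    unfolding power_p_minus_1 using bernpoly_quarter[OF odd_p_minus_2] by (simp add: mult.assoc)
  also have "Zp_cong p 1 \<dots> (- 4 * of_int (E (p - 3)) * (- 2))"
    by (intro Zp_cong_mult p_minus_2_cong Zp_cong_refl Zp_uminus Zp_mult) auto
  finally show ?thesis
    by simp
qed

text \<open>The powers in \<open>bernpoly_sixth_third\<close> have exponent \<open>p - 2\<close>; a
  factor 6 raises both to \<open>p - 1\<close>, where Fermat applies.\<close>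

lemma bernpoly_third_cong: "Zp_cong p 1 (bernpoly (p - 2) (1 / 3)) (6 * of_int (U (p - 3)))"
proof (rule Zp_cong_cancel_6)
  let ?B = "bernpoly (p - 2) (1 / 3)"
  have B: "?B \<in> Zp p"
    using prime p_gt_3 Zp_fraction_6[of 3 1 1] by (intro Zp_bernpoly) auto
  have "Zp_cong p 1 (2 * 1 * (1 + 2) * ?B) (2 * 3 ^ (p - 1) * (2 ^ (p - 1) + 2) * ?B)"
    using B by (intro Zp_cong_mult Zp_cong_add Zp_cong_sym[OF Zp_fermat_2] Zp_cong_sym[OF Zp_fermat_3] Zp_cong_refl) auto
  also have "2 * 3 ^ (p - 1) * (2 ^ (p - 1) + 2) * ?B = 6 * (2 * 3 ^ (p - 2) * (2 ^ (p - 2) + 1) * ?B)"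
    unfolding power_p_minus_1 by (simp add: algebra_simps)
  also have "\<dots> = - 18 * of_int (U (p - 3)) * of_nat (p - 2)"
    unfolding bernpoly_sixth_third(2)[OF odd_p_minus_2] by simp
  also have "Zp_cong p 1 \<dots> (- 18 * of_int (U (p - 3)) * (- 2))"
    by (intro Zp_cong_mult p_minus_2_cong Zp_cong_refl Zp_uminus Zp_mult) auto
  finally show "Zp_cong p 1 (6 * ?B) (6 * (6 * of_int (U (p - 3))))"
    by simp
qed

lemma bernpoly_sixth_cong: "Zp_cong p 1 (bernpoly (p - 2) (1 / 6)) (30 * of_int (U (p - 3)))"
proof -
  have B: "bernpoly (p - 2) (1 / 6) \<in> Zp p"
    using prime p_gt_3 Zp_fraction_6[of 6 1 1] by (intro Zp_bernpoly) auto
  from Zp_cong_mult[OF Zp_cong_sym[OF Zp_fermat_6] Zp_cong_refl[OF this]]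
  have "Zp_cong p 1 (bernpoly (p - 2) (1 / 6)) (6 ^ (p - 1) * bernpoly (p - 2) (1 / 6))"
    by simp
  also have "\<dots> = (6 ^ (p - 1) + 4 * 3 ^ (p - 1)) * bernpoly (p - 2) (1 / 3)"
    unfolding power_p_minus_1 using bernpoly_sixth_third(1)[OF odd_p_minus_2] by (simp add: algebra_simps)
  also have "Zp_cong p 1 \<dots> ((1 + 4 * 1) * (6 * of_int (U (p - 3))))"
    by (intro Zp_cong_mult Zp_cong_add Zp_fermat_6 Zp_fermat_3 bernpoly_third_cong Zp_cong_refl Zp_numeral)
  finally show ?thesis
    by simp
qed

text \<open>The bounds leave \<open>d\<close> equal to 3, 4 or 6, the case where 1 and -1 are the
  only units modulo \<open>d\<close>; hence \<open>a\<close> is 1 or \<open>d - 1\<close>. Here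
  \<open>x' = - a / d\<close>, so \<open>1 + 2 x'\<close> is \<open>1 + 2 x\<close> up to sign, and
  \<open>x' * (x' + 1)\<close> is the same for both \<open>a\<close>.\<close>

lemma sum_V_neg_inverse_cong:
  assumes d: "2 < d" "d dvd 6 ^ k" "d \<le> 6" and r: "d * r + 1 = a * p" and a: "a = 1 \<or> a = d - 1"
    and B: "Zp_cong p 1 (bernpoly (p - 2) (1 / of_nat d)) b"
    and c: "c = (1 - (of_nat d - 1) / of_nat d ^ 2) / (1 - 2 / of_nat d)" "c \<in> Zp p"
  shows "Zp_cong p 4 (\<Sum>n<p. V n (- 1 / of_nat d))
    ((if a = 1 then 1 else - 1) * of_nat p + of_nat p ^ 3 * (c * b))"
proof -
  define x :: rat where "x = - 1 / of_nat d"
  define x' :: rat where "x' = - of_nat a / of_nat d"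
  have d': "int d dvd 6 ^ k"
    using d(2) by (metis of_nat_dvd_iff of_nat_numeral of_nat_power)
  have x: "x \<in> Zp p" "x' \<in> Zp p"
    using Zp_fraction_6[OF _ d', of "- 1"] Zp_fraction_6[OF _ d', of "- int a"] d(1) by (simp_all add: x_def x'_def)
  have "(of_nat (d * r + 1) :: rat) = of_nat (a * p)"
    using r by (rule arg_cong)
  moreover have "x - of_nat r = - of_nat (d * r + 1) / of_nat d"
    using d(1) by (simp add: x_def field_simps)
  ultimately have xr: "x - of_nat r = of_nat p * x'"
    by (simp add: x'_def)
  have "d * r < d * p"
  proof -
    have "d * r < a * p"
      using r by simp
    also have "a * p \<le> d * p"
      using a d(1) by (intro mult_right_mono) auto
    finally show ?thesis .
  qed
  then have "Zp_residue p x = r"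
    using xr x by (intro Zp_residue_eqI prime Zp_congI[where c = x']) auto
  then have x'_eq: "x' = (x - of_nat (Zp_residue p x)) / of_nat p"
    using xr p_gt_3 by simp
  \<comment> \<open>Multiplied by \<open>d\<close>, the number becomes \<open>d - 2\<close>, which
    lies strictly between 0 and \<open>p\<close>.\<close>
  have "\<not> Zp_cong p 1 (2 * x + 1) 0"
  proof
    assume "Zp_cong p 1 (2 * x + 1) 0"
    from Zp_cong_mult[OF Zp_cong_refl[OF Zp_of_nat] this]
    have "Zp_cong p 1 (of_nat d * (2 * x + 1)) 0"
      by simp
    also have "of_nat d * (2 * x + 1) = of_nat (d - 2)"
      using d(1) by (simp add: x_def of_nat_diff right_diff_distrib)
    finally have "d - 2 = 0"
      using p_gt_4 d(3) by (intro Zp_cong_of_nat_eq[of p "d - 2" 0]) auto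
    with d(1) show False
      by simp
  qed
  from sum_V_cong[OF prime p_gt_3 x(1) this x'_eq]
  have "Zp_cong p 4 (\<Sum>n<p. V n x) ((1 + 2 * x') / (1 + 2 * x) * of_nat p
       + (x' * (x' + 1) + 1) / (1 + 2 * x) * of_nat p ^ 3 * bernpoly (p - 2) (- x))" .
  also have "(1 + 2 * x') / (1 + 2 * x) = (if a = 1 then 1 else - 1)"
    using a d(1) by (auto simp: x_def x'_def of_nat_diff field_simps)
  also have "(x' * (x' + 1) + 1) / (1 + 2 * x) = c"
  proof -
    have "x' * (x' + 1) + 1 = 1 - (of_nat d - 1) / of_nat d ^ 2"
      using a d(1) by (auto simp: x'_def of_nat_diff field_simps power2_eq_square)
    then show ?thesis
      by (simp add: c(1) x_def)
  qed
  also have "c * of_nat p ^ 3 * bernpoly (p - 2) (- x) = of_nat p ^ 3 * (c * bernpoly (p - 2) (1 / of_nat d))"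
    by (simp add: x_def)
  also have "Zp_cong p 4 ((if a = 1 then 1 else - 1) * of_nat p + of_nat p ^ 3 * (c * bernpoly (p - 2) (1 / of_nat d)))
      ((if a = 1 then 1 else - 1) * of_nat p + of_nat p ^ 3 * (c * b))"
    using Zp_cong_scale[OF Zp_cong_mult[OF Zp_cong_refl[OF c(2)] B], of 3]
    by (intro Zp_cong_add Zp_cong_refl) auto
  finally show ?thesis
    by (simp add: x_def)
qed

lemma sum_V_third_cong:
  "Zp_cong p 4 (\<Sum>n<p. V n (- 1 / 3)) ((- 1) ^ (p div 3) * of_nat p + 14 * of_nat p ^ 3 * of_int (U (p - 3)))"
proof -
  \<comment> \<open>For \<open>d = 3\<close> the constant is \<open>(1 - 2/9) / (1/3) = 7/3\<close>,
    and 6 times it is 14.\<close>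
  have *: "Zp_cong p 4 (\<Sum>n<p. V n (- 1 / of_nat 3))
    ((if a = 1 then 1 else - 1) * of_nat p + of_nat p ^ 3 * (7 / 3 * (6 * of_int (U (p - 3)))))"
    if "3 * r + 1 = a * p" "a = 1 \<or> a = 3 - 1" for a r
    using that bernpoly_third_cong Zp_fraction_6[of 3 1 7]
    by (intro sum_V_neg_inverse_cong[where k = 1 and r = r]) auto
  show ?thesis
  proof (rule p_cases_6)
    fix q assume "p = 6 * q + 1"
    moreover from this have "p div 3 = 2 * q"
      by simp
    ultimately show ?thesis
      using *[of "2 * q" 1] by (simp add: mult_ac)
  next
    fix q assume "p = 6 * q + 5"
    moreover from this have "p div 3 = 2 * q + 1"
      by simp
    ultimately show ?thesis
      \<comment> \<open>The residue of -1/3 is \<open>(2 p - 1) / 3 = 4 q + 3\<close>.\<close>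
      using *[of "4 * q + 3" 2] by (simp add: mult_ac)
  qed
qed

lemma sum_V_quarter_cong:
  "Zp_cong p 4 (\<Sum>n<p. V n (- 1 / 4)) ((- 1) ^ ((p - 1) div 2) * of_nat p + 13 * of_nat p ^ 3 * of_int (E (p - 3)))"
proof -
  \<comment> \<open>For \<open>d = 4\<close> the constant is
    \<open>(1 - 3/16) / (1/2) = 13/8\<close>, and 8 times it is 13.\<close>
  have *: "Zp_cong p 4 (\<Sum>n<p. V n (- 1 / of_nat 4))
    ((if a = 1 then 1 else - 1) * of_nat p + of_nat p ^ 3 * (13 / 8 * (8 * of_int (E (p - 3)))))"
    if "4 * r + 1 = a * p" "a = 1 \<or> a = 4 - 1" for a r
    using that bernpoly_quarter_cong Zp_fraction_6[of 8 3 13]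
    by (intro sum_V_neg_inverse_cong[where k = 2 and r = r]) auto
  have "p mod 4 = 1 \<or> p mod 4 = 3"
    using p_odd by presburger
  then obtain q where "p = 4 * q + 1 \<or> p = 4 * q + 3"
    by (metis mult_div_mod_eq)
  then show ?thesis
  proof
    assume "p = 4 * q + 1"
    then show ?thesis
      using *[of q 1] by (simp add: mult_ac)
  next
    assume "p = 4 * q + 3"
    moreover from this have "(p - 1) div 2 = 2 * q + 1"
      by simp
    ultimately show ?thesis
      using *[of "3 * q + 2" 3] by (simp add: mult_ac)
  qed
qed

lemma sum_V_sixth_cong:
  "Zp_cong p 4 (\<Sum>n<p. V n (- 1 / 6)) ((- 1) ^ (p div 3) * of_nat p + 155 / 4 * of_nat p ^ 3 * of_int (U (p - 3)))"
proof -
  \<comment> \<open>For \<open>d = 6\<close> the constant is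
    \<open>(1 - 5/36) / (2/3) = 31/24\<close>, and 30 times it is 155/4.\<close>
  have *: "Zp_cong p 4 (\<Sum>n<p. V n (- 1 / of_nat 6))
    ((if a = 1 then 1 else - 1) * of_nat p + of_nat p ^ 3 * (31 / 24 * (30 * of_int (U (p - 3)))))"
    if "6 * r + 1 = a * p" "a = 1 \<or> a = 6 - 1" for a r
    using that bernpoly_sixth_cong Zp_fraction_6[of 24 3 31]
    by (intro sum_V_neg_inverse_cong[where k = 1 and r = r]) auto
  show ?thesis
  proof (rule p_cases_6)
    fix q assume "p = 6 * q + 1"
    moreover from this have "p div 3 = 2 * q"
      by simp
    ultimately show ?thesis
      using *[of q 1] by (simp add: mult_ac)
  next
    fix q assume "p = 6 * q + 5"
    moreover from this have "p div 3 = 2 * q + 1"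
      by simp
    ultimately show ?thesis
      using *[of "5 * q + 4" 5] by (simp add: mult_ac)
  qed
qed

end

theorem theorem4p4:
  fixes p :: nat
  assumes "prime p" and "p > 3"
  shows "(\<forall>x\<in>Zp p. \<not> Zp_cong p 1 (2 * x + 1) 0 \<longrightarrow>
           (let x' = (x - of_nat (Zp_residue p x)) / of_nat p in
            Zp_cong p 4 (\<Sum>n=0..p - 1. V n x)
              ((1 + 2 * x') / (1 + 2 * x) * of_nat p
               + (x' * (x' + 1) + 1) / (1 + 2 * x) * of_nat p ^ 3 * bernpoly (p - 2) (- x))))
       \<and> Zp_cong p 4 (\<Sum>n=0..p - 1. V3 n / 27 ^ n)
           ((-1) ^ (p div 3) * of_nat p + 14 * of_nat p ^ 3 * of_int (U (p - 3)))
       \<and> Zp_cong p 4 (\<Sum>n=0..p - 1. V4 n / 64 ^ n)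
           ((-1) ^ ((p - 1) div 2) * of_nat p + 13 * of_nat p ^ 3 * of_int (E (p - 3)))
       \<and> Zp_cong p 4 (\<Sum>n=0..p - 1. V6 n / 432 ^ n)
           ((-1) ^ (p div 3) * of_nat p + 155 / 4 * of_nat p ^ 3 * of_int (U (p - 3)))"
proof -
  have "{0..p - 1} = {..<p}"
    using assms(2) by auto
  moreover have "V3 n / 27 ^ n = V n (- 1 / 3)" "V4 n / 64 ^ n = V n (- 1 / 4)" "V6 n / 432 ^ n = V n (- 1 / 6)" for n
    by (simp_all add: V3_def V4_def V6_def)
  ultimately show ?thesis
    using sum_V_cong[OF assms _ _ refl] sum_V_third_cong[OF assms] sum_V_quarter_cong[OF assms]
      sum_V_sixth_cong[OF assms]
    by (simp only: Let_def) blast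
qed

end
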